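(* $E_{2,0}$ is diffeomorphic to the total space of the unit tangent bundle of $S^4$. In fact, the Riemannian submersion $p_{1,1}:E_{2,0}\to S^4$ that is given by $$p_{1,1}:\ \mathrm{orbit}\begin{pmatrix}a&b\\ c&d\end{pmatrix}\mapsto \tilde h(c,d)$$ is bundle isomorphic to the unit tangent bundle of $S^4$, where $\tilde h:S^7\to S^4$ is the Hopf fibration given by left multiplication.
   Context: $Sp(2)$ is the group of $2\times2$ quaternionic matrices $Q$ with $Q^*Q=I$; $S^3$ is the group of unit quaternions. $E_{2,0}=Sp(2)/A_{2,0}$ is the quotient of $Sp(2)$ by the free $S^3$-action $A_{2,0}\big(p,\begin{pmatrix}a&b\\ c&d\end{pmatrix}\big)=\begin{pmatrix}p a&p b\\ p c&p d\end{pmatrix}$, and "orbit" denotes the $A_{2,0}$-orbit. The Hopf fibration $\tilde h$ is the quotient map of $S^7\subset\mathbb H^2$ by the action $p\cdot(c,d)=(pc,pd)$ of the unit quaternions. Metrics: let $A^u(p,Q)=\mathrm{diag}(p,1)Q$, $A^d(p,Q)=\mathrm{diag}(1,p)Q$, $A^l(q,Q)=Q\,\mathrm{diag}(\bar q,1)$, $A^r(q,Q)=Q\,\mathrm{diag}(1,\bar q)$ be the four commuting $S^3$-actions on $Sp(2)$. $Sp(2)$ carries a metric obtained from the biinvariant metric by Cheeger's method with $G=(S^3)^4$ acting by $A^u\times A^d\times A^l\times A^r$, i.e. the metric making $G\times Sp(2)\to Sp(2)$, $(p,m)\mapsto pm$, a Riemannian submersion, where $G$ has a biinvariant (product) metric.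 All four actions, hence also $A_{2,0}$, are by isometries, and $E_{2,0}$ carries the metric for which $Sp(2)\to E_{2,0}$ is a Riemannian submersion. The map $p_{1,1}$ is the map $Sp(2)/A_{2,0}\to Sp(2)/(A^u\times A^d)=S^4$ induced by the inclusion of $A_{2,0}$ in $A^u\times A^d$, and $S^4$ is given the quotient metric. *)

theory Defs
  imports "HOL-Analysis.Analysis"
begin

section \<open>Quaternions\<close>

datatype quat = Quat (qRe: real) (qI: real) (qJ: real) (qK: real)

lemma quat_eq_iff: "x = y \<longleftrightarrow> qRe x = qRe y \<and> qI x = qI y \<and> qJ x = qJ y \<and> qK x = qK y"
  by (cases x; cases y) auto

instantiation quat :: ring_1
begin

definition "0 = Quat 0 0 0 0"
definition "1 = Quat 1 0 0 0"
definition "x + y = Quat (qRe x + qRe y) (qI x + qI y) (qJ x + qJ y) (qK x + qK y)"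
definition "x - y = Quat (qRe x - qRe y) (qI x - qI y) (qJ x - qJ y) (qK x - qK y)"
definition "- x = Quat (- qRe x) (- qI x) (- qJ x) (- qK x)"
definition "x * y = Quat
  (qRe x * qRe y - qI x * qI y - qJ x * qJ y - qK x * qK y)
  (qRe x * qI y + qI x * qRe y + qJ x * qK y - qK x * qJ y)
  (qRe x * qJ y - qI x * qK y + qJ x * qRe y + qK x * qI y)
  (qRe x * qK y + qI x * qJ y - qJ x * qI y + qK x * qRe y)"

instance
  by intro_classes
    (auto simp: zero_quat_def one_quat_def plus_quat_def minus_quat_def uminus_quat_def
      times_quat_def quat_eq_iff algebra_simps)

end

instantiation quat :: real_inner
begin

definition "scaleR r x = Quat (r * qRe x) (r * qI x) (r * qJ x) (r * qK x)"
definition "inner x y = qRe x * qRe y + qI x * qI y + qJ x * qJ y + qK x * qK y"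
definition "norm x = sqrt (inner x x)" for x :: quat
definition "sgn x = scaleR (inverse (norm x)) x" for x :: quat
definition "dist x y = norm (x - y)" for x y :: quat
definition "uniformity = (INF e\<in>{0<..}. principal {(x, y). dist x (y::quat) < e})"
definition "open (U :: quat set) \<longleftrightarrow> (\<forall>x\<in>U. eventually (\<lambda>(x', y). x' = x \<longrightarrow> y \<in> U) uniformity)"

instance
proof
  fix x y z :: quat and r s :: real
  show "0 \<le> inner x x" by (simp add: inner_quat_def)
  show "(inner x x = 0) = (x = 0)"
  proof
    assume "inner x x = 0"
    hence e: "qRe x * qRe x + qI x * qI x + qJ x * qJ x + qK x * qK x = 0"
      by (simp add: inner_quat_def)
    have "0 \<le> qRe x * qRe x" "0 \<le> qI x * qI x" "0 \<le> qJ x * qJ x" "0 \<le> qK x * qK x" by auto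
    with e have "qRe x * qRe x = 0" "qI x * qI x = 0" "qJ x * qJ x = 0" "qK x * qK x = 0"
      by linarith+
    thus "x = 0" by (simp add: quat_eq_iff zero_quat_def)
  qed (simp add: inner_quat_def zero_quat_def)
  show "scaleR r (x + y) = scaleR r x + scaleR r y" "scaleR (r + s) x = scaleR r x + scaleR s x"
    "scaleR r (scaleR s x) = scaleR (r * s) x" "scaleR 1 x = x"
    by (simp_all add: scaleR_quat_def plus_quat_def algebra_simps)
  show "inner x y = inner y x" "inner (x + y) z = inner x z + inner y z"
    "inner (scaleR r x) y = r * inner x y"
    by (simp_all add: inner_quat_def scaleR_quat_def plus_quat_def algebra_simps)
qed (fact norm_quat_def sgn_quat_def dist_quat_def uniformity_quat_def open_quat_def)+

end

instantiation quat :: euclidean_space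
begin

definition "Basis = {Quat 1 0 0 0, Quat 0 1 0 0, Quat 0 0 1 0, Quat 0 0 0 1}"

instance
proof
  fix x u v :: quat
  show "(Basis :: quat set) \<noteq> {}" "finite (Basis :: quat set)"
    by (simp_all add: Basis_quat_def)
  show "u \<in> Basis \<Longrightarrow> v \<in> Basis \<Longrightarrow> inner u v = (if u = v then 1 else 0)"
    unfolding Basis_quat_def by (elim insertE emptyE) (simp_all add: inner_quat_def)
  show "(\<forall>u\<in>Basis. inner x u = 0) = (x = 0)"
    by (cases x) (simp add: Basis_quat_def inner_quat_def zero_quat_def)
qed

end

definition qcnj :: "quat \<Rightarrow> quat"
  where "qcnj x = Quat (qRe x) (- qI x) (- qJ x) (- qK x)"


section \<open>Smooth spaces\<close>

primrec Ck_on :: "nat \<Rightarrow> 'a::euclidean_space set \<Rightarrow> ('a \<Rightarrow> real) \<Rightarrow> bool"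
  where
    "Ck_on 0 U f \<longleftrightarrow> continuous_on U f"
  | "Ck_on (Suc k) U f \<longleftrightarrow>
      (\<exists>f'. (\<forall>x\<in>U. (f has_derivative f' x) (at x)) \<and> (\<forall>v. Ck_on k U (\<lambda>x. f' x v)))"

definition smooth_on :: "'a::euclidean_space set \<Rightarrow> ('a \<Rightarrow> real) \<Rightarrow> bool"
  where "smooth_on U f \<longleftrightarrow> (\<forall>k. Ck_on k U f)"

text \<open>
  A manifold is represented by its points together with its algebra of smooth real functions.
  Functions are total, but only their values on the points matter: in all spaces below
  membership in \<open>funs\<close> is insensitive to changes off \<open>points\<close>.
\<close>

record 'a smooth_space =
  points :: "'a set"
  funs :: "('a \<Rightarrow> real) set"

text \<open>The smooth structure of an embedded submanifold of a Euclidean space.\<close>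

definition submfd :: "'a::euclidean_space set \<Rightarrow> 'a smooth_space"
  where "submfd S = \<lparr>points = S,
    funs = {f. \<forall>x\<in>S. \<exists>U F. open U \<and> x \<in> U \<and> smooth_on U F \<and> (\<forall>y\<in>U \<inter> S. f y = F y)}\<rparr>"

definition smooth_map :: "'a smooth_space \<Rightarrow> 'b smooth_space \<Rightarrow> ('a \<Rightarrow> 'b) \<Rightarrow> bool"
  where "smooth_map X Y f \<longleftrightarrow> f ` points X \<subseteq> points Y \<and> (\<forall>h\<in>funs Y. h \<circ> f \<in> funs X)"

definition diffeomorphism :: "'a smooth_space \<Rightarrow> 'b smooth_space \<Rightarrow> ('a \<Rightarrow> 'b) \<Rightarrow> bool"
  where "diffeomorphism X Y f \<longleftrightarrow> bij_betw f (points X) (points Y) \<and>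
    smooth_map X Y f \<and> smooth_map Y X (inv_into (points X) f)"

definition diffeomorphic :: "'a smooth_space \<Rightarrow> 'b smooth_space \<Rightarrow> bool"
  where "diffeomorphic X Y \<longleftrightarrow> (\<exists>f. diffeomorphism X Y f)"

text \<open>Isomorphism of smooth fibre bundles \<open>p: X \<rightarrow> B\<close> and \<open>q: Y \<rightarrow> B\<close> over the identity of \<open>B\<close>.\<close>

definition bundle_isomorphic ::
    "'a smooth_space \<Rightarrow> ('a \<Rightarrow> 'c) \<Rightarrow> 'b smooth_space \<Rightarrow> ('b \<Rightarrow> 'c) \<Rightarrow> bool"
  where "bundle_isomorphic X p Y q \<longleftrightarrow>
    (\<exists>\<Phi>. diffeomorphism X Y \<Phi> \<and> (\<forall>x\<in>points X. q (\<Phi> x) = p x))"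


section \<open>Orbit spaces\<close>

definition orbit :: "('g \<Rightarrow> 'a \<Rightarrow> 'a) \<Rightarrow> 'g set \<Rightarrow> 'a \<Rightarrow> 'a set"
  where "orbit act G x = (\<lambda>g. act g x) ` G"

definition orbit_space ::
    "'a smooth_space \<Rightarrow> ('g \<Rightarrow> 'a \<Rightarrow> 'a) \<Rightarrow> 'g set \<Rightarrow> 'a set smooth_space"
  where "orbit_space X act G = \<lparr>points = orbit act G ` points X,
    funs = {f. f \<circ> orbit act G \<in> funs X}\<rparr>"

text \<open>The map on orbits induced by a map that is constant on each of them.\<close>

definition descend :: "('a \<Rightarrow> 'b) \<Rightarrow> 'a set \<Rightarrow> 'b"
  where "descend f C = the_elem (f ` C)"


section \<open>Tangent vectors and Riemannian metrics\<close>

text \<open>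
  Tangent vectors are derivations of the algebra of smooth functions, extended by 0 to all
  functions so that equality of derivations is equality of HOL functions.
\<close>

type_synonym 'a tvec = "('a \<Rightarrow> real) \<Rightarrow> real"
type_synonym 'a metric = "'a \<Rightarrow> 'a tvec \<Rightarrow> 'a tvec \<Rightarrow> real"

definition tangent_space :: "'a smooth_space \<Rightarrow> 'a \<Rightarrow> 'a tvec set"
  where "tangent_space X x = {D.
    (\<forall>f. f \<notin> funs X \<longrightarrow> D f = 0) \<and>
    (\<forall>f\<in>funs X. \<forall>c. D (\<lambda>y. c * f y) = c * D f) \<and>
    (\<forall>f\<in>funs X. \<forall>h\<in>funs X. D (\<lambda>y. f y + h y) = D f + D h) \<and>
    (\<forall>f\<in>funs X. \<forall>h\<in>funs X. D (\<lambda>y. f y * h y) = f x * D h + h x * D f)}"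

definition differential :: "'b smooth_space \<Rightarrow> ('a \<Rightarrow> 'b) \<Rightarrow> 'a tvec \<Rightarrow> 'b tvec"
  where "differential Y f D = (\<lambda>h. if h \<in> funs Y then D (h \<circ> f) else 0)"

definition smooth_vector_field :: "'a smooth_space \<Rightarrow> ('a \<Rightarrow> 'a tvec) \<Rightarrow> bool"
  where "smooth_vector_field X V \<longleftrightarrow>
    (\<forall>x\<in>points X. V x \<in> tangent_space X x) \<and> (\<forall>f\<in>funs X. (\<lambda>x. V x f) \<in> funs X)"

definition riemannian_metric :: "'a smooth_space \<Rightarrow> 'a metric \<Rightarrow> bool"
  where "riemannian_metric X g \<longleftrightarrow>
    (\<forall>x\<in>points X. \<forall>D\<in>tangent_space X x. \<forall>E\<in>tangent_space X x. \<forall>F\<in>tangent_space X x. \<forall>c.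
       g x D E = g x E D \<and>
       g x (\<lambda>f. D f + E f) F = g x D F + g x E F \<and>
       g x (\<lambda>f. c * D f) E = c * g x D E \<and>
       (D \<noteq> (\<lambda>_. 0) \<longrightarrow> g x D D > 0)) \<and>
    (\<forall>V W. smooth_vector_field X V \<longrightarrow> smooth_vector_field X W \<longrightarrow>
       (\<lambda>x. g x (V x) (W x)) \<in> funs X)"

definition preserves_metric :: "'a smooth_space \<Rightarrow> 'a metric \<Rightarrow> ('a \<Rightarrow> 'a) \<Rightarrow> bool"
  where "preserves_metric X g f \<longleftrightarrow>
    (\<forall>x\<in>points X. \<forall>D\<in>tangent_space X x. \<forall>E\<in>tangent_space X x.
       g (f x) (differential X f D) (differential X f E) = g x D E)"

definition biinvariant_metric ::
    "'a smooth_space \<Rightarrow> ('a \<Rightarrow> 'a \<Rightarrow> 'a) \<Rightarrow> 'a metric \<Rightarrow> bool"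
  where "biinvariant_metric X m g \<longleftrightarrow> riemannian_metric X g \<and>
    (\<forall>a\<in>points X. preserves_metric X g (\<lambda>x. m a x) \<and> preserves_metric X g (\<lambda>x. m x a))"

text \<open>The product metric on \<open>S \<times> T\<close>: the sum of the pullbacks along the two projections.\<close>

definition product_metric ::
    "'a::euclidean_space set \<Rightarrow> 'a metric \<Rightarrow> 'b::euclidean_space set \<Rightarrow> 'b metric \<Rightarrow> ('a \<times> 'b) metric"
  where "product_metric S g T h = (\<lambda>z D E.
    g (fst z) (differential (submfd S) fst D) (differential (submfd S) fst E) +
    h (snd z) (differential (submfd T) snd D) (differential (submfd T) snd E))"

definition horizontal_space ::
    "'a smooth_space \<Rightarrow> 'a metric \<Rightarrow> 'b smooth_space \<Rightarrow> ('a \<Rightarrow> 'b) \<Rightarrow> 'a \<Rightarrow> 'a tvec set"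
  where "horizontal_space X g Y f x = {D \<in> tangent_space X x.
    \<forall>K\<in>tangent_space X x. differential Y f K = (\<lambda>_. 0) \<longrightarrow> g x D K = 0}"

definition riemannian_submersion ::
    "'a smooth_space \<Rightarrow> 'a metric \<Rightarrow> 'b smooth_space \<Rightarrow> 'b metric \<Rightarrow> ('a \<Rightarrow> 'b) \<Rightarrow> bool"
  where "riemannian_submersion X g Y h f \<longleftrightarrow>
    riemannian_metric X g \<and> riemannian_metric Y h \<and> smooth_map X Y f \<and>
    (\<forall>x\<in>points X.
       differential Y f ` horizontal_space X g Y f x = tangent_space Y (f x) \<and>
       (\<forall>D\<in>horizontal_space X g Y f x. \<forall>E\<in>horizontal_space X g Y f x.
          h (f x) (differential Y f D) (differential Y f E) = g x D E))"

text \<open>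
  For a submanifold of a Euclidean space, a derivation \<open>D\<close> is identified with the ambient
  vector whose components are the values of \<open>D\<close> on the coordinate functions. Under this
  identification the tangent bundle is a submanifold of the square of the ambient space.
\<close>

definition ambient_vector :: "'a::euclidean_space tvec \<Rightarrow> 'a"
  where "ambient_vector D = (\<Sum>b\<in>Basis. D (\<lambda>y. y \<bullet> b) *\<^sub>R b)"

definition induced_metric :: "'a::euclidean_space metric"
  where "induced_metric x D E = ambient_vector D \<bullet> ambient_vector E"

definition unit_tangent_bundle ::
    "'a::euclidean_space set \<Rightarrow> 'a metric \<Rightarrow> ('a \<times> 'a) smooth_space"
  where "unit_tangent_bundle S g =
    submfd {(x, ambient_vector D) | x D. x \<in> S \<and> D \<in> tangent_space (submfd S) x \<and> g x D D = 1}"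


section \<open>The group Sp(2) and its actions\<close>

type_synonym qmat = "quat^2^2"

definition qadjoint :: "qmat \<Rightarrow> qmat"
  where "qadjoint Q = (\<chi> i j. qcnj (Q $ j $ i))"

definition qdiag :: "quat \<Rightarrow> quat \<Rightarrow> qmat"
  where "qdiag p q = vector [vector [p, 0], vector [0, q]]"

definition Sp2 :: "qmat set"
  where "Sp2 = {Q. qadjoint Q ** Q = mat 1}"

definition S3 :: "quat set"
  where "S3 = sphere 0 1"

definition S7 :: "(quat \<times> quat) set"
  where "S7 = sphere 0 1"

definition S4 :: "(quat \<times> real) set"
  where "S4 = sphere 0 1"

definition A_u :: "quat \<Rightarrow> qmat \<Rightarrow> qmat" where "A_u p Q = qdiag p 1 ** Q"
definition A_d :: "quat \<Rightarrow> qmat \<Rightarrow> qmat" where "A_d p Q = qdiag 1 p ** Q"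
definition A_l :: "quat \<Rightarrow> qmat \<Rightarrow> qmat" where "A_l q Q = Q ** qdiag (qcnj q) 1"
definition A_r :: "quat \<Rightarrow> qmat \<Rightarrow> qmat" where "A_r q Q = Q ** qdiag 1 (qcnj q)"

definition A_ud :: "quat \<times> quat \<Rightarrow> qmat \<Rightarrow> qmat"
  where "A_ud = (\<lambda>(p, q) Q. A_u p (A_d q Q))"

definition A_udlr :: "quat \<times> quat \<times> quat \<times> quat \<Rightarrow> qmat \<Rightarrow> qmat"
  where "A_udlr = (\<lambda>(p1, p2, q1, q2) Q. A_u p1 (A_d p2 (A_l q1 (A_r q2 Q))))"

definition A20 :: "quat \<Rightarrow> qmat \<Rightarrow> qmat"
  where "A20 p Q = (\<chi> i j. p * Q $ i $ j)"

definition E20 :: "qmat set smooth_space"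
  where "E20 = orbit_space (submfd Sp2) A20 S3"

text \<open>
  \<open>g\<close> is the Cheeger metric on \<open>Sp(2)\<close> obtained from \<open>g0\<close> on \<open>Sp(2)\<close> and the product of
  \<open>b1\<close>, \<open>b2\<close>, \<open>b3\<close>, \<open>b4\<close> on \<open>(S\<^sup>3)\<^sup>4\<close>.
\<close>

definition cheeger_metric ::
    "qmat metric \<Rightarrow> quat metric \<Rightarrow> quat metric \<Rightarrow> quat metric \<Rightarrow> quat metric \<Rightarrow> qmat metric \<Rightarrow> bool"
  where "cheeger_metric g0 b1 b2 b3 b4 g \<longleftrightarrow>
    riemannian_submersion
      (submfd ((S3 \<times> S3 \<times> S3 \<times> S3) \<times> Sp2))
      (product_metric (S3 \<times> S3 \<times> S3 \<times> S3)
         (product_metric S3 b1 (S3 \<times> S3 \<times> S3)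
            (product_metric S3 b2 (S3 \<times> S3)
               (product_metric S3 b3 S3 b4)))
         Sp2 g0)
      (submfd Sp2) g
      (\<lambda>(p, m). A_udlr p m)"


section \<open>The Hopf fibration and the projection to the 4-sphere\<close>

definition hopf_action :: "quat \<Rightarrow> quat \<times> quat \<Rightarrow> quat \<times> quat"
  where "hopf_action p = (\<lambda>(c, d). (p * c, p * d))"

text \<open>
  A concrete model of the quotient map of \<open>hopf_action\<close> with values in the unit sphere of
  \<open>\<H> \<times> \<real>\<close>; the theorem includes the claim that \<open>descend hopf\<close> is a diffeomorphism.
\<close>

definition hopf :: "quat \<times> quat \<Rightarrow> quat \<times> real"
  where "hopf = (\<lambda>(c, d). (2 *\<^sub>R (qcnj c * d), (norm c)\<^sup>2 - (norm d)\<^sup>2))"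

definition lower_row :: "qmat \<Rightarrow> quat \<times> quat"
  where "lower_row Q = (Q $ 2 $ 1, Q $ 2 $ 2)"

text \<open>The identification of \<open>Sp(2) / (A\<^sup>u \<times> A\<^sup>d)\<close> with the 4-sphere.\<close>

definition S4_ident :: "qmat set \<Rightarrow> quat \<times> real"
  where "S4_ident = descend (hopf \<circ> lower_row)"

text \<open>
  Since \<open>A20 p = A_ud (p, p)\<close>, the union below is the single orbit of \<open>A\<^sup>u \<times> A\<^sup>d\<close> that
  contains the given \<open>A20\<close>-orbit.
\<close>

definition p11 :: "qmat set \<Rightarrow> quat \<times> real"
  where "p11 C = S4_ident (\<Union>Q\<in>C. orbit A_ud (S3 \<times> S3) Q)"

end

theory Submission
  imports Defs
begin

text \<open>
  A matrix \<open>Q\<close> in Sp(2) with rows \<open>(a, b)\<close> and \<open>(c, d)\<close> determines the quaternionic line spanned by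
  its lower row, and its upper row spans the orthogonal line. The tangent space of the projective
  line \<open>S\<^sup>4\<close> at a line \<open>L\<close> consists of the linear maps from \<open>L\<close> to its orthogonal complement, and
  the map that sends the lower row of \<open>Q\<close> to the upper row is a unit vector in it. Multiplying
  both rows from the left by the same unit quaternion does not change this map. So \<open>Q\<close>
  gives a unit tangent vector of \<open>S\<^sup>4\<close> that depends only on the orbit of \<open>Q\<close> under \<open>A20\<close>.

  The computations use Hermitian matrices. Embed \<open>\<H> \<times> \<real>\<close> as the traceless Hermitian
  matrices by \<open>herm\<close>; the anticommutator of two of them is twice their inner product
  (\<open>herm_anticommutator\<close>). With \<open>\<delta> = diag(-1, 1)\<close> and \<open>\<sigma>\<close> the matrix that swaps the two basis
  vectors, the Hopf image of the lower row of \<open>Q\<close> is \<open>Q\<^sup>* \<delta> Q\<close> and the tangent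
  vector is \<open>Q\<^sup>* \<sigma> Q\<close> (\<open>herm_base_pt\<close>, \<open>herm_frame_vec\<close>). As \<open>\<delta>\<close> and \<open>\<sigma>\<close> square to 1 and
  anticommute, the two vectors are orthonormal. Two matrices of Sp(2) have the same image in \<open>S\<^sup>4\<close>
  exactly when their quotient commutes with \<open>\<delta>\<close>, that is, has the form \<open>diag(p, q)\<close>; they have
  the same tangent vector, too, exactly when it also commutes with \<open>\<sigma>\<close>, that is, when \<open>p = q\<close>.
  Local sections come from two charts of \<open>S\<^sup>4\<close> (\<open>base_pt_local_section\<close>) and from
  rotating the upper row (\<open>frame_lift\<close>). A smooth map whose
  fibres are the orbits and that has smooth local sections induces a diffeomorphism on the orbit
  space (\<open>orbit_space_diffeomorphism\<close>); this gives the three identifications of quotients.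

  Tangent vectors are derivations, so one must know that a derivation of the smooth functions on a
  submanifold is a directional derivative in the ambient space. This is Hadamard's lemma
  together with a bump function (\<open>derivation_eq_frechet\<close>). It follows that the derivations at a
  point \<open>x\<close> of a sphere are the vectors orthogonal to \<open>x\<close>, and that a Riemannian metric on the
  sphere is a quadratic form in them with smooth coefficients. Rescaling vectors is
  therefore an isomorphism between the unit tangent bundles of any two Riemannian metrics
  (\<open>unit_tangent_bundles_isomorphic\<close>).

  Finally, if \<open>p\<close> and \<open>q \<circ> p\<close> are Riemannian submersions, then so is \<open>q\<close>, because \<open>p\<close> maps the
  horizontal space of \<open>q \<circ> p\<close> onto that of \<open>q\<close> (\<open>riemannian_submersion_factor\<close>).
  Here \<open>p\<close> is the projection from Sp(2) to \<open>E20\<close> and \<open>q\<close> is \<open>p11\<close>.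
\<close>

section \<open>Calculus of \<open>C\<^sup>k\<close> functions\<close>

lemma Ck_on_subset: "Ck_on k U f \<Longrightarrow> V \<subseteq> U \<Longrightarrow> Ck_on k V f"
proof (induction k arbitrary: f)
  case 0 then show ?case by (auto intro: continuous_on_subset)
next
  case (Suc k) then show ?case by (simp; blast)
qed

lemma Ck_on_cong:
  assumes "open U" "\<And>x. x \<in> U \<Longrightarrow> f x = g x" "Ck_on k U f"
  shows "Ck_on k U g"
proof (cases k)
  case 0 with assms show ?thesis by (auto cong: continuous_on_cong)
next
  case (Suc l)
  with assms(3) obtain f' where "\<And>x. x \<in> U \<Longrightarrow> (f has_derivative f' x) (at x)"
    and "\<And>v. Ck_on l U (\<lambda>x. f' x v)" by auto
  moreover from this have "(g has_derivative f' x) (at x)" if "x \<in> U" for x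
    using has_derivative_transform_within_open[OF _ assms(1) that] assms(2) that by blast
  ultimately show ?thesis using Suc by auto
qed

lemma Ck_on_SucE:
  assumes "Ck_on (Suc k) U f"
  obtains f' where "\<And>x. x \<in> U \<Longrightarrow> (f has_derivative f' x) (at x)"
    and "\<And>v. Ck_on k U (\<lambda>x. f' x v)"
  using assms unfolding Ck_on.simps(2) by blast

lemma Ck_on_SucD: "Ck_on (Suc k) U f \<Longrightarrow> Ck_on k U f"
proof (induction k arbitrary: f)
  case 0
  then show ?case
    by (auto intro!: continuous_at_imp_continuous_on intro: has_derivative_continuous)
next
  case (Suc k)
  from Suc.prems(1) obtain f' where "\<And>x. x \<in> U \<Longrightarrow> (f has_derivative f' x) (at x)"
    and "\<And>v. Ck_on (Suc k) U (\<lambda>x. f' x v)" unfolding Ck_on.simps(2)[of "Suc k"] by blast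
  with Suc.IH show ?case unfolding Ck_on.simps(2)[of k] by blast
qed

lemma Ck_on_imp_continuous_on: "Ck_on k U f \<Longrightarrow> continuous_on U f"
  by (induction k) (auto dest: Ck_on_SucD simp del: Ck_on.simps(2))

text \<open>
  On an open set derivatives are unique, so the existential quantifier over derivatives in \<open>Ck_on\<close>
  can be replaced by the Frechet derivative; this is what makes \<open>Ck_on\<close> a local property.
\<close>

lemma Ck_on_Suc_frechet:
  assumes "open U"
  shows "Ck_on (Suc k) U f \<longleftrightarrow> (\<forall>x\<in>U. f differentiable at x) \<and>
    (\<forall>v. Ck_on k U (\<lambda>x. frechet_derivative f (at x) v))"
proof
  assume "Ck_on (Suc k) U f"
  then obtain f' where f': "\<And>x. x \<in> U \<Longrightarrow> (f has_derivative f' x) (at x)"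
    and C: "\<And>v. Ck_on k U (\<lambda>x. f' x v)" by auto
  have "f' x = frechet_derivative f (at x)" if "x \<in> U" for x
    using f'[OF that] by (rule frechet_derivative_at)
  then have "Ck_on k U (\<lambda>x. frechet_derivative f (at x) v)" for v
    by (intro Ck_on_cong[OF assms _ C[of v]]) simp
  with f' show "(\<forall>x\<in>U. f differentiable at x) \<and>
    (\<forall>v. Ck_on k U (\<lambda>x. frechet_derivative f (at x) v))" by (auto simp: differentiable_def)
next
  assume "(\<forall>x\<in>U. f differentiable at x) \<and> (\<forall>v. Ck_on k U (\<lambda>x. frechet_derivative f (at x) v))"
  then show "Ck_on (Suc k) U f"
    by (auto simp: frechet_derivative_works intro!: exI[of _ "\<lambda>x. frechet_derivative f (at x)"])
qed

lemma Ck_on_local: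
  assumes "open U" "\<And>x. x \<in> U \<Longrightarrow> \<exists>V. open V \<and> x \<in> V \<and> Ck_on k V f"
  shows "Ck_on k U f"
  using assms(2)
proof (induction k arbitrary: f)
  case 0
  then show ?case
    by (auto simp: continuous_on_eq_continuous_at assms(1)) (meson continuous_on_eq_continuous_at)
next
  case (Suc k)
  have *: "\<exists>V. open V \<and> x \<in> V \<and> (\<forall>y\<in>V. f differentiable at y) \<and>
      (\<forall>v. Ck_on k V (\<lambda>y. frechet_derivative f (at y) v))" if "x \<in> U" for x
    using Suc.prems[OF that] by (metis Ck_on_Suc_frechet)
  show ?case unfolding Ck_on_Suc_frechet[OF assms(1)]
  proof (intro conjI ballI allI)
    show "f differentiable at x" if "x \<in> U" for x using *[OF that] by blast
    show "Ck_on k U (\<lambda>x. frechet_derivative f (at x) v)" for v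
      by (rule Suc.IH) (use * in blast)
  qed
qed

lemma Ck_on_const: "Ck_on k U (\<lambda>_. c)"
  by (induction k arbitrary: c) (auto intro!: exI[of _ "\<lambda>_ _. 0"])

lemma Ck_on_linear: "bounded_linear f \<Longrightarrow> Ck_on k U f"
  by (cases k) (auto intro!: exI[of _ "\<lambda>_. f"] Ck_on_const bounded_linear_imp_has_derivative
      linear_continuous_on)

lemma Ck_on_add: "Ck_on k U f \<Longrightarrow> Ck_on k U g \<Longrightarrow> Ck_on k U (\<lambda>x. f x + g x)"
proof (induction k arbitrary: f g)
  case 0 then show ?case by (auto intro: continuous_intros)
next
  case (Suc k)
  from Suc.prems(1) obtain f' where "\<And>x. x \<in> U \<Longrightarrow> (f has_derivative f' x) (at x)"
    "\<And>v. Ck_on k U (\<lambda>x. f' x v)" by (rule Ck_on_SucE) blast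
  moreover from Suc.prems(2) obtain g' where "\<And>x. x \<in> U \<Longrightarrow> (g has_derivative g' x) (at x)"
    "\<And>v. Ck_on k U (\<lambda>x. g' x v)" by (rule Ck_on_SucE) blast
  ultimately show ?case
    by (auto intro!: exI[of _ "\<lambda>x v. f' x v + g' x v"] Suc.IH has_derivative_add)
qed

lemma Ck_on_mult: "Ck_on k U f \<Longrightarrow> Ck_on k U g \<Longrightarrow> Ck_on k U (\<lambda>x. f x * g x)"
proof (induction k arbitrary: f g)
  case 0 then show ?case by (auto intro: continuous_intros)
next
  case (Suc k)
  from Suc.prems have fg: "Ck_on k U f" "Ck_on k U g" by (auto dest: Ck_on_SucD simp del: Ck_on.simps)
  from Suc.prems(1) obtain f' where "\<And>x. x \<in> U \<Longrightarrow> (f has_derivative f' x) (at x)"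
    "\<And>v. Ck_on k U (\<lambda>x. f' x v)" by (rule Ck_on_SucE) blast
  moreover from Suc.prems(2) obtain g' where "\<And>x. x \<in> U \<Longrightarrow> (g has_derivative g' x) (at x)"
    "\<And>v. Ck_on k U (\<lambda>x. g' x v)" by (rule Ck_on_SucE) blast
  ultimately show ?case using fg
    by (auto intro!: exI[of _ "\<lambda>x v. f x * g' x v + f' x v * g x"] Ck_on_add Suc.IH
        has_derivative_mult)
qed

lemma Ck_on_sum: "(\<And>i. i \<in> I \<Longrightarrow> Ck_on k U (f i)) \<Longrightarrow> Ck_on k U (\<lambda>x. \<Sum>i\<in>I. f i x)"
  by (induction I rule: infinite_finite_induct) (auto intro: Ck_on_add Ck_on_const)

text \<open>
  By the chain rule the derivative of \<open>f \<circ> g\<close> is the sum of the partial derivatives of \<open>f\<close>, composed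
  with \<open>g\<close>, times the derivatives of the components of \<open>g\<close>. The induction therefore has to be
  over all \<open>f\<close>.
\<close>

lemma Ck_on_compose:
  assumes "open U" "g ` U \<subseteq> V" "Ck_on k V f"
    and "\<And>b. b \<in> Basis \<Longrightarrow> Ck_on k U (\<lambda>x. g x \<bullet> b)"
  shows "Ck_on k U (\<lambda>x. f (g x))"
  using assms(3,4)
proof (induction k arbitrary: f)
  case 0
  then have "continuous_on U g"
    by (auto intro: continuous_on_componentwise[THEN iffD2])
  with 0 assms(2) show ?case by (auto intro: continuous_on_compose2)
next
  case (Suc k)
  from Suc.prems(1) obtain f' where f': "\<And>y. y \<in> V \<Longrightarrow> (f has_derivative f' y) (at y)"
    and Cf': "\<And>v. Ck_on k V (\<lambda>y. f' y v)" by auto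
  define g' where "g' x v = (\<Sum>b\<in>Basis. frechet_derivative (\<lambda>x. g x \<bullet> b) (at x) v *\<^sub>R b)" for x v
  have gb: "((\<lambda>x. g x \<bullet> b) has_derivative frechet_derivative (\<lambda>x. g x \<bullet> b) (at x)) (at x)"
    and Cg: "Ck_on k U (\<lambda>x. frechet_derivative (\<lambda>x. g x \<bullet> b) (at x) v)"
    if "x \<in> U" "b \<in> Basis" for x b v
    using Suc.prems(2)[OF that(2)] that(1)
    by (auto simp: Ck_on_Suc_frechet[OF assms(1)] frechet_derivative_works simp del: Ck_on.simps)
  have g': "(g has_derivative g' x) (at x)" if "x \<in> U" for x
  proof -
    have "((\<lambda>x. \<Sum>b\<in>Basis. (g x \<bullet> b) *\<^sub>R b) has_derivative g' x) (at x)"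
      unfolding g'_def by (intro has_derivative_sum has_derivative_scaleR_left gb that)
    then show ?thesis by (simp add: euclidean_representation)
  qed
  have f'_lin: "f' (g x) (g' x v) =
      (\<Sum>b\<in>Basis. f' (g x) b * frechet_derivative (\<lambda>x. g x \<bullet> b) (at x) v)" if "x \<in> U" for x v
  proof -
    have "linear (f' (g x))" using f' that assms(2) has_derivative_linear by blast
    then show ?thesis
      by (simp add: g'_def linear_sum linear_cmul mult.commute)
  qed
  have C: "Ck_on k U (\<lambda>x. f' (g x) (g' x v))" for v
  proof (rule Ck_on_cong[OF assms(1)])
    show "(\<Sum>b\<in>Basis. f' (g x) b * frechet_derivative (\<lambda>x. g x \<bullet> b) (at x) v) = f' (g x) (g' x v)"
      if "x \<in> U" for x by (simp add: f'_lin that)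
    have gk: "\<And>b. b \<in> Basis \<Longrightarrow> Ck_on k U (\<lambda>x. g x \<bullet> b)"
      using Suc.prems(2) by (auto dest: Ck_on_SucD simp del: Ck_on.simps)
    show "Ck_on k U (\<lambda>x. \<Sum>b\<in>Basis. f' (g x) b * frechet_derivative (\<lambda>x. g x \<bullet> b) (at x) v)"
    proof (cases "U = {}")
      case True
      then show ?thesis using Ck_on_cong[of "{}" "\<lambda>_. 0" _ k] Ck_on_const by blast
    next
      case False
      then show ?thesis
        by (intro Ck_on_sum Ck_on_mult) (use Cg Suc.IH[OF Cf' gk] in auto)
    qed
  qed
  show ?case unfolding Ck_on.simps(2)
  proof (intro exI conjI ballI allI)
    fix x assume "x \<in> U"
    then show "((\<lambda>x. f (g x)) has_derivative (\<lambda>v. f' (g x) (g' x v))) (at x)"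
      using diff_chain_at[OF g' f'] assms(2) by (auto simp: o_def)
  qed (rule C)
qed

lemma Ck_on_Suc_real:
  assumes "\<And>x. x \<in> U \<Longrightarrow> (f has_real_derivative g x) (at x)" "Ck_on k U g"
  shows "Ck_on (Suc k) U f"
  using assms
  by (auto simp: has_field_derivative_def intro!: exI[of _ "\<lambda>x v. g x * v"] Ck_on_mult Ck_on_const)

lemma Ck_on_inverse: "0 \<notin> U \<Longrightarrow> Ck_on k U (inverse :: real \<Rightarrow> real)"
proof (induction k)
  case 0 then show ?case by (auto intro!: continuous_intros)
next
  case (Suc k)
  then have "Ck_on k U (\<lambda>x. - 1 * (inverse x * inverse x :: real))"
    by (intro Ck_on_mult Ck_on_const) auto
  with Suc.prems show ?case
    by (intro Ck_on_Suc_real) (auto intro!: derivative_eq_intros simp: power2_eq_square)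
qed

lemma Ck_on_sqrt: "Ck_on k {0<..} sqrt"
proof (induction k)
  case 0 then show ?case by (auto intro!: continuous_intros)
next
  case (Suc k)
  have "Ck_on k {0<..} (\<lambda>x. inverse (sqrt x))"
    by (rule Ck_on_compose[where V="-{0}"]) (auto intro!: Ck_on_inverse Suc)
  then have "Ck_on k {0<..} (\<lambda>x. inverse (sqrt x) * (1/2))"
    by (intro Ck_on_mult Ck_on_const)
  then show ?case
    by (intro Ck_on_Suc_real)
      (auto intro!: derivative_eq_intros simp: inverse_eq_divide)
qed

text \<open>
  The function \<open>exp (-1/t)\<close>, continued by 0, is the building block of bump functions. The extra
  factors \<open>t\<^sup>-\<^sup>n\<close> make the family closed under differentiation.
\<close>

definition flat_exp :: "nat \<Rightarrow> real \<Rightarrow> real"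
  where "flat_exp n t = (if t > 0 then exp (- inverse t) * inverse t ^ n else 0)"

lemma flat_exp_tendsto_0: "(flat_exp n \<longlongrightarrow> 0) (at 0)"
proof -
  have "((\<lambda>t. inverse t ^ n / exp (inverse t)) \<longlongrightarrow> (0::real)) (at_right 0)"
    by (rule filterlim_compose[OF tendsto_power_div_exp_0 filterlim_inverse_at_top_right])
  then have "(flat_exp n \<longlongrightarrow> 0) (at_right 0)"
    by (rule Lim_transform_eventually)
      (auto simp: eventually_at_right_less flat_exp_def exp_minus field_simps eventually_at_filter)
  moreover have "(flat_exp n \<longlongrightarrow> 0) (at_left 0)"
    by (rule Lim_transform_eventually[OF tendsto_const])
      (auto simp: flat_exp_def eventually_at_filter)
  ultimately show ?thesis by (simp add: filterlim_at_split)
qed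

lemma flat_exp_has_derivative:
  "(flat_exp n has_real_derivative flat_exp (n+2) t - real n * flat_exp (n+1) t) (at t)"
proof (cases t "0::real" rule: linorder_cases)
  case less
  have "((\<lambda>_. 0) has_real_derivative 0) (at t)" by simp
  then have "(flat_exp n has_real_derivative 0) (at t)"
    by (rule has_field_derivative_transform_within_open[where S="{..<0}"])
      (use less in \<open>auto simp: flat_exp_def\<close>)
  with less show ?thesis by (simp add: flat_exp_def)
next
  case equal
  have "((\<lambda>h. (flat_exp n (0 + h) - flat_exp n 0) / h) \<longlongrightarrow> 0) (at 0)"
    by (rule Lim_transform_eventually[OF flat_exp_tendsto_0[of "Suc n"]])
      (auto simp: flat_exp_def eventually_at_filter field_simps)
  with equal show ?thesis by (simp add: DERIV_def flat_exp_def)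
next
  case greater
  have e: "((\<lambda>t. exp (- inverse t)) has_real_derivative exp (- inverse t) * inverse t ^ 2) (at t)"
    and p: "((\<lambda>t. inverse t ^ n) has_real_derivative
      real n * (inverse t ^ (n - Suc 0) * - (inverse t ^ 2))) (at t)"
    using greater by (auto intro!: derivative_eq_intros simp: power2_eq_square)
  have n: "real n * inverse t ^ (n - Suc 0) = real n * inverse t ^ n * t"
    using greater by (cases n) auto
  have "((\<lambda>t. exp (- inverse t) * inverse t ^ n) has_real_derivative
      flat_exp (n+2) t - real n * flat_exp (n+1) t) (at t)"
    by (rule DERIV_cong[OF DERIV_mult[OF e p]])
      (use greater n in \<open>auto simp: flat_exp_def power_add power2_eq_square field_simps\<close>)
  then show ?thesis
    by (rule has_field_derivative_transform_within_open[where S="{0<..}"])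
      (use greater in \<open>auto simp: flat_exp_def\<close>)
qed

lemma Ck_on_flat_exp: "Ck_on k UNIV (flat_exp n)"
proof (induction k arbitrary: n)
  case 0
  then show ?case
    by (auto intro!: continuous_at_imp_continuous_on DERIV_isCont flat_exp_has_derivative)
next
  case (Suc k)
  have "Ck_on k UNIV (\<lambda>t. flat_exp (n+2) t + (- real n) * flat_exp (n+1) t)"
    by (intro Ck_on_add Ck_on_mult Ck_on_const Suc)
  then show ?case
    by (intro Ck_on_Suc_real) (use flat_exp_has_derivative in auto)
qed

section \<open>Smooth maps between submanifolds\<close>

lemma points_submfd [simp]: "points (submfd S) = S"
  by (simp add: submfd_def)

lemma mem_funs_submfd_iff: "f \<in> funs (submfd S) \<longleftrightarrow>
    (\<forall>x\<in>S. \<exists>U F. open U \<and> x \<in> U \<and> smooth_on U F \<and> (\<forall>y\<in>U \<inter> S. f y = F y))"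
  by (simp add: submfd_def)

lemma smooth_on_subset: "smooth_on U F \<Longrightarrow> V \<subseteq> U \<Longrightarrow> smooth_on V F"
  unfolding smooth_on_def by (blast intro: Ck_on_subset)

lemma smooth_on_imp_funs: "open U \<Longrightarrow> smooth_on U F \<Longrightarrow> S \<subseteq> U \<Longrightarrow> F \<in> funs (submfd S)"
  unfolding mem_funs_submfd_iff by blast

lemma funs_cong:
  assumes f: "f \<in> funs (submfd S)" and eq: "\<And>x. x \<in> S \<Longrightarrow> f x = g x"
  shows "g \<in> funs (submfd S)"
proof -
  have "(\<forall>y\<in>U \<inter> S. f y = F y) = (\<forall>y\<in>U \<inter> S. g y = F y)" for U F by (simp add: eq)
  with f show ?thesis unfolding mem_funs_submfd_iff by simp
qed

lemma funs_local:
  assumes "\<And>x. x \<in> S \<Longrightarrow> \<exists>U. open U \<and> x \<in> U \<and> f \<in> funs (submfd (S \<inter> U))"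
  shows "f \<in> funs (submfd S)"
  unfolding mem_funs_submfd_iff
proof
  fix x assume x: "x \<in> S"
  obtain U where U: "open U" "x \<in> U" "f \<in> funs (submfd (S \<inter> U))" using assms[OF x] by blast
  then obtain V F where "open V" "x \<in> V" "smooth_on V F" "\<forall>y\<in>V \<inter> (S \<inter> U). f y = F y"
    using x unfolding mem_funs_submfd_iff by blast
  then show "\<exists>U F. open U \<and> x \<in> U \<and> smooth_on U F \<and> (\<forall>y\<in>U \<inter> S. f y = F y)"
    using U by (intro exI[of _ "U \<inter> V"] exI[of _ F]) (auto intro: smooth_on_subset)
qed

text \<open>
  Smoothness of a vector-valued map by components. Unlike \<open>smooth_map\<close> it does not mention a target,
  so it has closure rules for every algebraic operation.
\<close>

definition smooth_vec :: "'a::euclidean_space set \<Rightarrow> ('a \<Rightarrow> 'b::euclidean_space) \<Rightarrow> bool"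
  where "smooth_vec S f \<longleftrightarrow> (\<forall>b\<in>Basis. (\<lambda>x. f x \<bullet> b) \<in> funs (submfd S))"

lemma smooth_vec_real_iff: "smooth_vec S f \<longleftrightarrow> f \<in> funs (submfd S)" for f :: "_ \<Rightarrow> real"
  by (simp add: smooth_vec_def)

lemma smooth_vec_cong: "smooth_vec S f \<Longrightarrow> (\<And>x. x \<in> S \<Longrightarrow> f x = g x) \<Longrightarrow> smooth_vec S g"
  unfolding smooth_vec_def by (auto intro: funs_cong)

lemma smooth_vec_extend:
  assumes "smooth_vec S f" "x \<in> S"
  obtains U \<Phi> where "open U" "x \<in> U" "\<And>b. b \<in> Basis \<Longrightarrow> smooth_on U (\<lambda>y. \<Phi> y \<bullet> b)"
    "\<And>y. y \<in> U \<inter> S \<Longrightarrow> f y = \<Phi> y"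
proof -
  have "\<forall>b\<in>Basis. \<exists>U F. open U \<and> x \<in> U \<and> smooth_on U F \<and> (\<forall>y\<in>U \<inter> S. f y \<bullet> b = F y)"
    using assms unfolding smooth_vec_def mem_funs_submfd_iff by blast
  then obtain U F where UF: "\<And>b. b \<in> Basis \<Longrightarrow> open (U b) \<and> x \<in> U b \<and> smooth_on (U b) (F b) \<and>
      (\<forall>y\<in>U b \<inter> S. f y \<bullet> b = F b y)" by metis
  define V where "V = (\<Inter>b\<in>Basis. U b)"
  define \<Phi> where "\<Phi> y = (\<Sum>b\<in>Basis. F b y *\<^sub>R b)" for y
  have \<Phi>: "\<Phi> y \<bullet> b = F b y" if "b \<in> Basis" for y b
    using that by (simp add: \<Phi>_def)
  show thesis
  proof
    show "open V" "x \<in> V" using UF by (auto simp: V_def)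
    show "smooth_on V (\<lambda>y. \<Phi> y \<bullet> b)" if "b \<in> Basis" for b
      unfolding \<Phi>[OF that] using UF[OF that] that
      by (auto simp: V_def intro: smooth_on_subset)
    show "f y = \<Phi> y" if "y \<in> V \<inter> S" for y
      by (rule euclidean_eqI) (use UF that in \<open>auto simp: \<Phi> V_def\<close>)
  qed
qed

lemma funs_compose:
  assumes "smooth_vec S f" "f ` S \<subseteq> T" "h \<in> funs (submfd T)"
  shows "(\<lambda>x. h (f x)) \<in> funs (submfd S)"
  unfolding mem_funs_submfd_iff
proof
  fix x assume x: "x \<in> S"
  obtain U \<Phi> where U: "open U" "x \<in> U" "\<And>b. b \<in> Basis \<Longrightarrow> smooth_on U (\<lambda>y. \<Phi> y \<bullet> b)"
    "\<And>y. y \<in> U \<inter> S \<Longrightarrow> f y = \<Phi> y" using smooth_vec_extend[OF assms(1) x] by blast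
  have "f x \<in> T" using assms(2) x by blast
  then obtain V H where V: "open V" "f x \<in> V" "smooth_on V H" "\<forall>y\<in>V \<inter> T. h y = H y"
    using assms(3) unfolding mem_funs_submfd_iff by blast
  have "continuous_on U (\<lambda>y. \<Phi> y \<bullet> b)" if "b \<in> Basis" for b
    using U(3)[OF that] unfolding smooth_on_def by (blast intro: Ck_on_imp_continuous_on)
  then have "continuous_on U \<Phi>"
    by (auto intro: continuous_on_componentwise[THEN iffD2])
  then have W: "open (U \<inter> \<Phi> -` V)" using U(1) V(1) by (rule continuous_open_preimage)
  have "smooth_on (U \<inter> \<Phi> -` V) (\<lambda>y. H (\<Phi> y))"
    unfolding smooth_on_def
  proof
    fix k show "Ck_on k (U \<inter> \<Phi> -` V) (\<lambda>y. H (\<Phi> y))"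
      by (rule Ck_on_compose[OF W])
        (use U(3) V(3) in \<open>auto simp: smooth_on_def intro: Ck_on_subset\<close>)
  qed
  moreover have "x \<in> U \<inter> \<Phi> -` V" using U V x by auto
  moreover have "h (f y) = H (\<Phi> y)" if "y \<in> (U \<inter> \<Phi> -` V) \<inter> S" for y
    using that U(4)[of y] V(4) assms(2) by auto
  ultimately show "\<exists>U F. open U \<and> x \<in> U \<and> smooth_on U F \<and> (\<forall>y\<in>U \<inter> S. h (f y) = F y)"
    using W by blast
qed

lemma smooth_vec_compose:
  assumes "smooth_vec S f" "f ` S \<subseteq> T" "smooth_vec T h"
  shows "smooth_vec S (\<lambda>x. h (f x))"
  unfolding smooth_vec_def
proof
  fix b :: 'c assume "b \<in> Basis"
  then show "(\<lambda>x. h (f x) \<bullet> b) \<in> funs (submfd S)"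
    using funs_compose[OF assms(1,2), of "\<lambda>y. h y \<bullet> b"] assms(3) by (simp add: smooth_vec_def)
qed

lemma smooth_vec_const [intro, simp]: "smooth_vec S (\<lambda>_. c)"
  unfolding smooth_vec_def by (rule ballI, rule smooth_on_imp_funs[of UNIV]) (simp_all add: smooth_on_def Ck_on_const)

lemma smooth_vec_bounded_linear:
  assumes "bounded_linear f"
  shows "smooth_vec S f"
  unfolding smooth_vec_def
proof
  fix b :: 'b
  have "Ck_on k UNIV (\<lambda>x. f x \<bullet> b)" for k
    by (intro Ck_on_linear bounded_linear_inner_left_comp assms)
  then show "(\<lambda>x. f x \<bullet> b) \<in> funs (submfd S)"
    by (intro smooth_on_imp_funs[of UNIV]) (simp_all add: smooth_on_def)
qed

lemma smooth_vec_id: "smooth_vec S (\<lambda>x. x)"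
  by (intro smooth_vec_bounded_linear bounded_linear_ident)

lemma smooth_vec_linear_comp: "bounded_linear h \<Longrightarrow> smooth_vec S f \<Longrightarrow> smooth_vec S (\<lambda>x. h (f x))"
  by (rule smooth_vec_compose[of S f UNIV h]) (simp_all add: smooth_vec_bounded_linear)

lemma smooth_vec_Pair: "smooth_vec S f \<Longrightarrow> smooth_vec S g \<Longrightarrow> smooth_vec S (\<lambda>x. (f x, g x))"
  unfolding smooth_vec_def by (auto simp: Basis_prod_def)

lemma smooth_vec_add: "smooth_vec S f \<Longrightarrow> smooth_vec S g \<Longrightarrow> smooth_vec S (\<lambda>x. f x + g x)"
  using smooth_vec_linear_comp[OF bounded_linear_add[OF bounded_linear_fst bounded_linear_snd]
      smooth_vec_Pair, of S f g] by simp

lemma smooth_vec_uminus: "smooth_vec S f \<Longrightarrow> smooth_vec S (\<lambda>x. - f x)"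
  by (rule smooth_vec_linear_comp[OF bounded_linear_minus[OF bounded_linear_ident]])

lemma smooth_vec_diff: "smooth_vec S f \<Longrightarrow> smooth_vec S g \<Longrightarrow> smooth_vec S (\<lambda>x. f x - g x)"
  using smooth_vec_add[of S f "\<lambda>x. - g x"] smooth_vec_uminus[of S g] by simp

lemma smooth_vec_sum: "(\<And>i. i \<in> I \<Longrightarrow> smooth_vec S (f i)) \<Longrightarrow> smooth_vec S (\<lambda>x. \<Sum>i\<in>I. f i x)"
  by (induction I rule: infinite_finite_induct) (auto intro: smooth_vec_add)

lemma funs_mult:
  assumes "f \<in> funs (submfd S)" "g \<in> funs (submfd S)"
  shows "(\<lambda>x. f x * g x :: real) \<in> funs (submfd S)"
proof -
  have "(\<lambda>p::real\<times>real. fst p * snd p) \<in> funs (submfd UNIV)"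
    by (rule smooth_on_imp_funs[of UNIV])
      (simp_all add: smooth_on_def Ck_on_mult Ck_on_linear bounded_linear_fst bounded_linear_snd)
  from funs_compose[OF smooth_vec_Pair _ this, of S f g] assms show ?thesis
    by (simp add: smooth_vec_real_iff)
qed

lemma smooth_vec_mult: "smooth_vec S f \<Longrightarrow> smooth_vec S g \<Longrightarrow> smooth_vec S (\<lambda>x. f x * g x)"
  for f g :: "'a::euclidean_space \<Rightarrow> real"
  unfolding smooth_vec_real_iff by (rule funs_mult)

lemma bounded_bilinear_inner_expand:
  fixes h :: "'b::euclidean_space \<Rightarrow> 'c::euclidean_space \<Rightarrow> 'd::euclidean_space"
  assumes "bounded_bilinear h"
  shows "h u v \<bullet> b = (\<Sum>i\<in>Basis. \<Sum>j\<in>Basis. (u \<bullet> i) * (v \<bullet> j) * (h i j \<bullet> b))"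
proof -
  interpret bounded_bilinear h by fact
  have "h u v = h (\<Sum>i\<in>Basis. (u \<bullet> i) *\<^sub>R i) v"
    by (simp only: euclidean_representation)
  also have "\<dots> \<bullet> b = (\<Sum>i\<in>Basis. (u \<bullet> i) * (h i v \<bullet> b))"
    by (simp only: sum_left scaleR_left inner_sum_left inner_scaleR_left)
  also have "\<dots> = (\<Sum>i\<in>Basis. (u \<bullet> i) * (\<Sum>j\<in>Basis. (v \<bullet> j) * (h i j \<bullet> b)))"
  proof (intro sum.cong refl arg_cong2[where f="(*)"])
    fix i
    have "h i v = h i (\<Sum>j\<in>Basis. (v \<bullet> j) *\<^sub>R j)"
      by (simp only: euclidean_representation)
    then show "h i v \<bullet> b = (\<Sum>j\<in>Basis. (v \<bullet> j) * (h i j \<bullet> b))"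
      by (simp only: sum_right scaleR_right inner_sum_left inner_scaleR_left)
  qed
  finally show ?thesis by (simp only: sum_distrib_left mult.assoc)
qed

text \<open>
  In coordinates a bilinear map is a polynomial. This covers the products of
  quaternions and of matrices, scaling and inner products at once.
\<close>

lemma smooth_vec_bilinear:
  fixes f :: "'a::euclidean_space \<Rightarrow> 'b::euclidean_space" and g :: "'a \<Rightarrow> 'c::euclidean_space"
    and h :: "'b \<Rightarrow> 'c \<Rightarrow> 'd::euclidean_space"
  assumes h: "bounded_bilinear h" and "smooth_vec S f" "smooth_vec S g"
  shows "smooth_vec S (\<lambda>x. h (f x) (g x))"
  unfolding smooth_vec_def
proof
  fix b :: 'd
  have "smooth_vec S (\<lambda>x. f x \<bullet> i)" "smooth_vec S (\<lambda>x. g x \<bullet> j)" for i j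
    by (rule smooth_vec_linear_comp[OF bounded_linear_inner_left], fact)+
  then have "smooth_vec S (\<lambda>x. \<Sum>i\<in>Basis. \<Sum>j\<in>Basis. (f x \<bullet> i) * (g x \<bullet> j) * (h i j \<bullet> b))"
    by (intro smooth_vec_sum smooth_vec_mult smooth_vec_const)
  moreover have "(\<lambda>x. h (f x) (g x) \<bullet> b) =
      (\<lambda>x. \<Sum>i\<in>Basis. \<Sum>j\<in>Basis. (f x \<bullet> i) * (g x \<bullet> j) * (h i j \<bullet> b))"
    by (rule ext) (rule bounded_bilinear_inner_expand[OF h])
  ultimately show "(\<lambda>x. h (f x) (g x) \<bullet> b) \<in> funs (submfd S)"
    by (simp only: smooth_vec_real_iff)
qed

lemmas smooth_vec_scaleR = smooth_vec_bilinear[OF bounded_bilinear_scaleR]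
lemmas smooth_vec_inner = smooth_vec_bilinear[OF bounded_bilinear_inner]

lemma smooth_vec_inverse:
  fixes f :: "'a::euclidean_space \<Rightarrow> real"
  assumes "smooth_vec S f" "\<And>x. x \<in> S \<Longrightarrow> f x \<noteq> 0"
  shows "smooth_vec S (\<lambda>x. inverse (f x))"
proof -
  have inv: "inverse \<in> funs (submfd (-{0::real}))"
    by (rule smooth_on_imp_funs[of "-{0}"]) (auto simp: smooth_on_def Ck_on_inverse)
  have "f ` S \<subseteq> -{0}" using assms(2) by force
  from funs_compose[OF assms(1) this inv] show ?thesis by (simp add: smooth_vec_real_iff)
qed

lemma smooth_vec_sqrt:
  fixes f :: "'a::euclidean_space \<Rightarrow> real"
  assumes "smooth_vec S f" "\<And>x. x \<in> S \<Longrightarrow> f x > 0"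
  shows "smooth_vec S (\<lambda>x. sqrt (f x))"
proof -
  have inv: "sqrt \<in> funs (submfd {0<..})"
    by (rule smooth_on_imp_funs[of "{0<..}"]) (auto simp: smooth_on_def Ck_on_sqrt)
  have "f ` S \<subseteq> {0<..}" using assms(2) by force
  from funs_compose[OF assms(1) this inv] show ?thesis by (simp add: smooth_vec_real_iff)
qed

lemma smooth_vec_imp_smooth_map:
  "smooth_vec S f \<Longrightarrow> f ` S \<subseteq> T \<Longrightarrow> smooth_map (submfd S) (submfd T) f"
  unfolding smooth_map_def by (simp add: o_def funs_compose)

lemma smooth_map_compose:
  "smooth_map X Y f \<Longrightarrow> smooth_map Y Z g \<Longrightarrow> smooth_map X Z (g \<circ> f)"
  unfolding smooth_map_def by (auto simp: o_assoc image_comp[symmetric])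

lemma diffeomorphism_submfdI:
  assumes "smooth_map (submfd S) (submfd T) f" "smooth_map (submfd T) (submfd S) g"
    and "\<And>x. x \<in> S \<Longrightarrow> g (f x) = x" "\<And>y. y \<in> T \<Longrightarrow> f (g y) = y"
  shows "diffeomorphism (submfd S) (submfd T) f"
proof -
  have fS: "f ` S \<subseteq> T" "g ` T \<subseteq> S" using assms(1,2) by (auto simp: smooth_map_def)
  then have bij: "bij_betw f S T" using assms(3,4) by (intro bij_betw_byWitness[of _ g]) auto
  have inv: "inv_into S f y = g y" if "y \<in> T" for y
    using that fS assms(4) bij inv_into_f_f[of f S "g y"] by (auto simp: bij_betw_def)
  have "h \<circ> inv_into S f \<in> funs (submfd T)" if "h \<in> funs (submfd S)" for h
    by (rule funs_cong[of "h \<circ> g"]) (use that assms(2) inv in \<open>auto simp: smooth_map_def\<close>)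
  then have "smooth_map (submfd T) (submfd S) (inv_into S f)"
    using fS inv by (auto simp: smooth_map_def)
  with bij assms(1) show ?thesis by (simp add: diffeomorphism_def)
qed

lemma diffeomorphism_compose:
  assumes f: "diffeomorphism X Y f" and g: "diffeomorphism Y (submfd T) g"
  shows "diffeomorphism X (submfd T) (g \<circ> f)"
proof -
  have b: "bij_betw f (points X) (points Y)" "bij_betw g (points Y) T"
    using f g by (auto simp: diffeomorphism_def)
  let ?i = "inv_into (points X) f \<circ> inv_into (points Y) g"
  have inv: "inv_into (points X) (g \<circ> f) y = ?i y" if "y \<in> T" for y
    using b that by (simp add: bij_betw_def inv_into_comp)
  have i: "smooth_map (submfd T) X ?i"
    using f g by (auto simp: diffeomorphism_def intro: smooth_map_compose)
  have "smooth_map (submfd T) X (inv_into (points X) (g \<circ> f))"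
    unfolding smooth_map_def
  proof (intro conjI ballI)
    show "inv_into (points X) (g \<circ> f) ` points (submfd T) \<subseteq> points X"
      using i inv by (auto simp: smooth_map_def)
    fix h assume "h \<in> funs X"
    then have "h \<circ> ?i \<in> funs (submfd T)" using i by (simp add: smooth_map_def)
    then show "h \<circ> inv_into (points X) (g \<circ> f) \<in> funs (submfd T)"
      by (rule funs_cong) (simp add: inv)
  qed
  with f g b show ?thesis
    by (auto simp: diffeomorphism_def intro: bij_betw_trans smooth_map_compose)
qed

section \<open>Orbit spaces with local sections\<close>

lemma descend_orbit:
  assumes "G \<noteq> {}" "\<And>g. g \<in> G \<Longrightarrow> \<pi> (act g x) = \<pi> x"
  shows "descend \<pi> (orbit act G x) = \<pi> x"
proof -
  have "\<pi> ` orbit act G x = (\<lambda>_. \<pi> x) ` G"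
    unfolding orbit_def image_image by (rule image_cong) (simp_all add: assms(2))
  then show ?thesis using assms(1) by (simp add: descend_def image_constant_conv)
qed

text \<open>
  The inverse of the induced map is, locally, a smooth section followed by the projection to the
  orbits. By definition of the smooth structure on the orbit space the latter is smooth, so the
  inverse is smooth although the orbit space has no charts.
\<close>

lemma orbit_space_diffeomorphism:
  assumes sm: "smooth_map (submfd S) (submfd T) \<pi>"
    and ne: "G \<noteq> {}" and stay: "\<And>g x. g \<in> G \<Longrightarrow> x \<in> S \<Longrightarrow> act g x \<in> S"
    and inva: "\<And>g x. g \<in> G \<Longrightarrow> x \<in> S \<Longrightarrow> \<pi> (act g x) = \<pi> x"
    and trans: "\<And>x y. x \<in> S \<Longrightarrow> y \<in> S \<Longrightarrow> \<pi> x = \<pi> y \<Longrightarrow> \<exists>g\<in>G. x = act g y"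
    and sec: "\<And>y. y \<in> T \<Longrightarrow> \<exists>U s. open U \<and> y \<in> U \<and> smooth_map (submfd (T \<inter> U)) (submfd S) s \<and>
      (\<forall>z\<in>T \<inter> U. \<pi> (s z) = z)"
  shows "diffeomorphism (orbit_space (submfd S) act G) (submfd T) (descend \<pi>)"
proof -
  let ?X = "orbit_space (submfd S) act G" and ?o = "orbit act G"
  have X: "points ?X = ?o ` S" "funs ?X = {f. f \<circ> ?o \<in> funs (submfd S)}"
    by (auto simp: orbit_space_def)
  have desc: "descend \<pi> (?o x) = \<pi> x" if "x \<in> S" for x
    by (rule descend_orbit) (use ne inva that in auto)
  have sub: "?o x \<subseteq> ?o y" if "x \<in> S" "y \<in> S" "\<pi> x = \<pi> y" for x y
  proof
    fix z assume "z \<in> ?o x"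
    then obtain g where g: "g \<in> G" "z = act g x" by (auto simp: orbit_def)
    with that stay inva have "z \<in> S" "\<pi> z = \<pi> y" by auto
    from trans[OF this(1) that(2) this(2)] show "z \<in> ?o y" by (auto simp: orbit_def)
  qed
  have inj: "?o x = ?o y" if "x \<in> S" "y \<in> S" "\<pi> x = \<pi> y" for x y
    using sub[OF that] sub[OF that(2,1) that(3)[symmetric]] by (rule equalityI)
  have surj: "\<exists>x\<in>S. \<pi> x = y" if "y \<in> T" for y
  proof -
    obtain U s where U: "y \<in> U" "s ` (T \<inter> U) \<subseteq> S" "\<forall>z\<in>T \<inter> U. \<pi> (s z) = z"
      using sec[OF \<open>y \<in> T\<close>] by (auto simp: smooth_map_def)
    then have "s y \<in> S" "\<pi> (s y) = y" using that by auto
    then show ?thesis by blast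
  qed
  have bij: "bij_betw (descend \<pi>) (points ?X) T"
  proof (rule bij_betw_imageI)
    show "inj_on (descend \<pi>) (points ?X)"
      unfolding X inj_on_def by (clarsimp simp: desc) (rule inj)
    have "descend \<pi> ` points ?X = \<pi> ` S"
      unfolding X image_image by (rule image_cong) (auto simp: desc)
    also have "\<dots> = T"
    proof
      show "\<pi> ` S \<subseteq> T" using sm by (simp add: smooth_map_def)
      show "T \<subseteq> \<pi> ` S" by (rule subsetI) (drule surj, blast)
    qed
    finally show "descend \<pi> ` points ?X = T" .
  qed
  have inv: "inv_into (points ?X) (descend \<pi>) (\<pi> x) = ?o x" if "x \<in> S" for x
    using bij that inv_into_f_f[of "descend \<pi>" "points ?X" "?o x"]
    by (simp add: bij_betw_def X desc)
  have "smooth_map ?X (submfd T) (descend \<pi>)"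
    unfolding smooth_map_def
  proof (intro conjI ballI)
    show "descend \<pi> ` points ?X \<subseteq> points (submfd T)" using bij by (simp add: bij_betw_def)
    fix h assume "h \<in> funs (submfd T)"
    then have "h \<circ> \<pi> \<in> funs (submfd S)" using sm by (simp add: smooth_map_def)
    then show "h \<circ> descend \<pi> \<in> funs ?X"
      unfolding X by (auto intro: funs_cong simp: desc)
  qed
  moreover have "smooth_map (submfd T) ?X (inv_into (points ?X) (descend \<pi>))"
    unfolding smooth_map_def
  proof (intro conjI ballI)
    show "inv_into (points ?X) (descend \<pi>) ` points (submfd T) \<subseteq> points ?X"
      using bij by (auto simp: bij_betw_def intro: inv_into_into)
    fix h assume "h \<in> funs ?X"
    then have h: "h \<circ> ?o \<in> funs (submfd S)" by (simp add: X)
    show "h \<circ> inv_into (points ?X) (descend \<pi>) \<in> funs (submfd T)"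
    proof (rule funs_local)
      fix y assume "y \<in> T"
      then obtain U s where U: "open U" "y \<in> U" "smooth_map (submfd (T \<inter> U)) (submfd S) s"
        "\<forall>z\<in>T \<inter> U. \<pi> (s z) = z" using sec by blast
      have "(h \<circ> ?o) \<circ> s \<in> funs (submfd (T \<inter> U))" using U(3) h by (simp add: smooth_map_def)
      then have "h \<circ> inv_into (points ?X) (descend \<pi>) \<in> funs (submfd (T \<inter> U))"
      proof (rule funs_cong)
        fix z assume z: "z \<in> T \<inter> U"
        then have "s z \<in> S" using U(3) by (auto simp: smooth_map_def)
        from inv[OF this] z U(4) show "(h \<circ> ?o \<circ> s) z = (h \<circ> inv_into (points ?X) (descend \<pi>)) z"
          by simp
      qed
      with U show "\<exists>U. open U \<and> y \<in> U \<and> h \<circ> inv_into (points ?X) (descend \<pi>) \<in> funs (submfd (T \<inter> U))"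
        by blast
    qed
  qed
  ultimately show ?thesis using bij by (simp add: diffeomorphism_def)
qed

section \<open>Hadamard's lemma\<close>

lemma segment_in_ball:
  fixes x :: "'a::real_normed_vector"
  assumes "y \<in> ball x r" "t \<in> {0..1}"
  shows "x + t *\<^sub>R (y - x) \<in> ball x r"
proof -
  have "dist x (x + t *\<^sub>R (y - x)) = \<bar>t\<bar> * norm (y - x)" by (simp add: dist_norm)
  also have "\<dots> \<le> norm (y - x)" using assms(2) by (simp add: mult_left_le_one_le)
  also have "\<dots> < r" using assms(1) by (simp add: dist_norm norm_minus_commute)
  finally show ?thesis by simp
qed

lemma continuous_on_segment:
  fixes x :: "'a::real_normed_vector"
  assumes "continuous_on (ball x r) h"
  shows "continuous_on (ball x r \<times> {0..1}) (\<lambda>(y, t). h (x + t *\<^sub>R (y - x)))"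
  unfolding case_prod_unfold
proof (rule continuous_on_compose2[OF assms])
  show "continuous_on (ball x r \<times> {0..1}) (\<lambda>p. x + snd p *\<^sub>R (fst p - x))"
    by (intro continuous_intros)
  show "(\<lambda>p. x + snd p *\<^sub>R (fst p - x)) ` (ball x r \<times> {0..1}) \<subseteq> ball x r"
    by (rule image_subsetI) (rule segment_in_ball; simp add: mem_Times_iff)
qed

text \<open>
  Differentiation under the integral sign. Each derivative in \<open>y\<close> brings out a factor \<open>t\<close>, which is why
  the statement is proved for all powers of \<open>t\<close> simultaneously.
\<close>

lemma Ck_on_segment_integral:
  fixes h :: "'a::euclidean_space \<Rightarrow> real"
  assumes "Ck_on k (ball x r) h"
  shows "Ck_on k (ball x r) (\<lambda>y. integral {0..1} (\<lambda>t. t ^ m * h (x + t *\<^sub>R (y - x))))"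
  using assms
proof (induction k arbitrary: h m)
  case 0
  note seg = segment_in_ball[of _ x r]
  have "continuous_on (ball x r \<times> cbox 0 1) (\<lambda>(y, t). t ^ m * h (x + t *\<^sub>R (y - x)))"
    using continuous_on_segment[of x r h] 0
    by (auto simp: case_prod_unfold intro!: continuous_intros)
  from integral_continuous_on_param[OF this] show ?case by simp
next
  case (Suc k)
  let ?B = "ball x r"
  note seg = segment_in_ball[of _ x r]
  from Suc.prems obtain h' where h': "\<And>y. y \<in> ?B \<Longrightarrow> (h has_derivative h' y) (at y)"
    and Ch': "\<And>v. Ck_on k ?B (\<lambda>y. h' y v)" by (rule Ck_on_SucE) blast
  have ch': "continuous_on ?B (\<lambda>y. h' y v)" for v using Ch' by (rule Ck_on_imp_continuous_on)
  have ch: "continuous_on ?B h" using Suc.prems by (rule Ck_on_imp_continuous_on)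
  define L where "L y t = Blinfun (\<lambda>v. t ^ m * h' (x + t *\<^sub>R (y - x)) (t *\<^sub>R v))" for y t
  have L: "blinfun_apply (L y t) = (\<lambda>v. t ^ m * h' (x + t *\<^sub>R (y - x)) (t *\<^sub>R v))"
    if "y \<in> ?B" "t \<in> {0..1}" for y t
    unfolding L_def
    by (rule bounded_linear_Blinfun_apply[OF bounded_linear_const_mult[OF
          bounded_linear_compose[OF _ bounded_linear_scaleR_right]]])
      (rule has_derivative_bounded_linear[OF h'[OF seg[OF that]]])
  have L': "blinfun_apply (L y t) v = t ^ Suc m * h' (x + t *\<^sub>R (y - x)) v"
    if "y \<in> ?B" "t \<in> {0..1}" for y t v
    by (simp add: L[OF that] linear_cmul[OF has_derivative_linear[OF h'[OF seg[OF that]]]])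
  have cL: "continuous_on (?B \<times> cbox 0 1) (\<lambda>(y, t). L y t)"
  proof (rule continuous_on_blinfun_componentwise)
    fix i :: 'a
    have "continuous_on (?B \<times> cbox 0 1) (\<lambda>p. snd p ^ Suc m * h' (x + snd p *\<^sub>R (fst p - x)) i)"
      using continuous_on_segment[OF ch', of i]
      by (auto simp: case_prod_unfold intro!: continuous_intros)
    then show "continuous_on (?B \<times> cbox 0 1) (\<lambda>p. blinfun_apply (case p of (y, t) \<Rightarrow> L y t) i)"
      by (rule continuous_on_eq) (auto simp: L')
  qed
  have der: "((\<lambda>y. integral (cbox 0 1) (\<lambda>t. t ^ m * h (x + t *\<^sub>R (y - x))))
      has_derivative integral (cbox 0 1) (L y)) (at y within ?B)" if y: "y \<in> ?B" for y
  proof (rule leibniz_rule[OF _ _ cL y convex_ball])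
    fix z and t :: real assume z: "z \<in> ?B" and t: "t \<in> cbox 0 1"
    have "((\<lambda>z. x + t *\<^sub>R (z - x)) has_derivative (\<lambda>v. t *\<^sub>R v)) (at z within ?B)"
      by (auto intro!: derivative_eq_intros)
    from has_derivative_compose[OF this h'] seg[OF z] t
    have "((\<lambda>z. h (x + t *\<^sub>R (z - x))) has_derivative
        (\<lambda>v. h' (x + t *\<^sub>R (z - x)) (t *\<^sub>R v))) (at z within ?B)"
      by simp
    then show "((\<lambda>z. t ^ m * h (x + t *\<^sub>R (z - x))) has_derivative blinfun_apply (L z t)) (at z within ?B)"
      using L[OF z] t by (auto intro: has_derivative_mult_right)
  next
    fix z assume z: "z \<in> ?B"
    have "continuous_on (cbox 0 1) (\<lambda>t. t ^ m * h (x + t *\<^sub>R (z - x)))"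
      by (intro continuous_intros continuous_on_compose2[OF ch] image_subsetI seg[OF z]) simp_all
    then show "(\<lambda>t. t ^ m * h (x + t *\<^sub>R (z - x))) integrable_on cbox 0 1"
      by (rule integrable_continuous)
  qed
  have app: "blinfun_apply (integral (cbox 0 1) (L y)) v =
      integral {0..1} (\<lambda>t. t ^ Suc m * h' (x + t *\<^sub>R (y - x)) v)" if y: "y \<in> ?B" for y v
  proof -
    have "continuous_on (cbox 0 1) (\<lambda>t. (\<lambda>(y, t). L y t) (y, t))"
      by (intro continuous_on_compose2[OF cL]) (use y in \<open>auto intro!: continuous_intros\<close>)
    then have "L y integrable_on cbox 0 1" by (simp add: integrable_continuous_interval)
    from integral_linear[OF this blinfun.bounded_linear_left[of v]]
    have "blinfun_apply (integral (cbox 0 1) (L y)) v = integral {0..1} (\<lambda>t. blinfun_apply (L y t) v)"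
      by (simp add: o_def)
    also have "\<dots> = integral {0..1} (\<lambda>t. t ^ Suc m * h' (x + t *\<^sub>R (y - x)) v)"
      by (rule integral_cong) (use L'[OF y] in simp)
    finally show ?thesis .
  qed
  show ?case unfolding Ck_on.simps(2)
  proof (intro exI conjI ballI allI)
    show "((\<lambda>y. integral {0..1} (\<lambda>t. t ^ m * h (x + t *\<^sub>R (y - x))))
      has_derivative blinfun_apply (integral (cbox 0 1) (L y))) (at y)" if "y \<in> ?B" for y
      using der[OF that] that by (simp add: at_within_open[OF _ open_ball])
    show "Ck_on k ?B (\<lambda>y. blinfun_apply (integral (cbox 0 1) (L y)) v)" for v
      by (rule Ck_on_cong[OF open_ball _ Suc.IH[OF Ch', of "Suc m" v]]) (rule app[symmetric])
  qed
qed

lemma smooth_on_imp_frechet: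
  assumes "open U" "smooth_on U F"
  shows "x \<in> U \<Longrightarrow> (F has_derivative frechet_derivative F (at x)) (at x)"
    and "smooth_on U (\<lambda>x. frechet_derivative F (at x) v)"
proof -
  have "Ck_on (Suc k) U F" for k using assms(2) by (simp only: smooth_on_def)
  note * = this[unfolded Ck_on_Suc_frechet[OF assms(1)] frechet_derivative_works]
  show "x \<in> U \<Longrightarrow> (F has_derivative frechet_derivative F (at x)) (at x)" using * by blast
  show "smooth_on U (\<lambda>x. frechet_derivative F (at x) v)" unfolding smooth_on_def using * by blast
qed

lemma smooth_on_imp_continuous_on: "smooth_on U F \<Longrightarrow> continuous_on U F"
  unfolding smooth_on_def using Ck_on.simps(1) by metis

text \<open>
  The coefficient \<open>G b\<close> is the average of the partial derivative in direction \<open>b\<close> over the segment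
  from \<open>x\<close> to \<open>y\<close>; the identity is the fundamental theorem of calculus along that segment.
\<close>

lemma hadamard:
  fixes F :: "'a::euclidean_space \<Rightarrow> real"
  assumes "smooth_on (ball x r) F"
  obtains G where "\<And>b. smooth_on (ball x r) (G b)"
    and "\<And>b. r > 0 \<Longrightarrow> G b x = frechet_derivative F (at x) b"
    and "\<And>y. y \<in> ball x r \<Longrightarrow> F y - F x = (\<Sum>b\<in>Basis. ((y - x) \<bullet> b) * G b y)"
proof
  let ?F' = "\<lambda>y. frechet_derivative F (at y)"
  let ?G = "\<lambda>b y. integral {0..1} (\<lambda>t. ?F' (x + t *\<^sub>R (y - x)) b)"
  note F' = smooth_on_imp_frechet[OF open_ball assms]
  show "smooth_on (ball x r) (?G b)" for b
    unfolding smooth_on_def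
    using Ck_on_segment_integral[of _ x r "\<lambda>y. ?F' y b" 0] F'(2)[of b]
    by (simp add: smooth_on_def)
  show "?G b x = ?F' x b" for b by simp
  show "F y - F x = (\<Sum>b\<in>Basis. ((y - x) \<bullet> b) * ?G b y)" if y: "y \<in> ball x r" for y
  proof -
    note seg = segment_in_ball[OF y]
    have c: "continuous_on {0..1} (\<lambda>t. ?F' (x + t *\<^sub>R (y - x)) b)" for b
    proof (rule continuous_on_compose2[of "ball x r" "\<lambda>y. ?F' y b"])
      show "continuous_on (ball x r) (\<lambda>y. ?F' y b)"
        using F'(2)[of b] by (rule smooth_on_imp_continuous_on)
      show "continuous_on {0..1} (\<lambda>t. x + t *\<^sub>R (y - x))" by (intro continuous_intros)
    qed (intro image_subsetI seg)
    have "((\<lambda>t. ?F' (x + t *\<^sub>R (y - x)) (y - x)) has_integral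
        F (x + 1 *\<^sub>R (y - x)) - F (x + 0 *\<^sub>R (y - x))) {0..1}"
    proof (rule fundamental_theorem_of_calculus)
      fix t :: real assume t: "t \<in> {0..1}"
      have "((\<lambda>t. x + t *\<^sub>R (y - x)) has_derivative (\<lambda>s. s *\<^sub>R (y - x))) (at t within {0..1})"
        by (auto intro!: derivative_eq_intros)
      from has_derivative_compose[OF this F'(1)[OF seg[OF t]]]
      have "((\<lambda>t. F (x + t *\<^sub>R (y - x))) has_derivative
          (\<lambda>s. ?F' (x + t *\<^sub>R (y - x)) (s *\<^sub>R (y - x)))) (at t within {0..1})" .
      then show "((\<lambda>t. F (x + t *\<^sub>R (y - x))) has_vector_derivative
          ?F' (x + t *\<^sub>R (y - x)) (y - x)) (at t within {0..1})"
        by (simp add: has_vector_derivative_def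
            linear_cmul[OF has_derivative_linear[OF F'(1)[OF seg[OF t]]]])
    qed simp
    then have "F y - F x = integral {0..1} (\<lambda>t. ?F' (x + t *\<^sub>R (y - x)) (y - x))"
      by (simp add: integral_unique)
    also have "\<dots> = integral {0..1} (\<lambda>t. \<Sum>b\<in>Basis. ((y - x) \<bullet> b) * ?F' (x + t *\<^sub>R (y - x)) b)"
    proof (rule integral_cong)
      fix t :: real assume t: "t \<in> {0..1}"
      have l: "linear (?F' (x + t *\<^sub>R (y - x)))"
        using F'(1)[OF seg[OF t]] by (rule has_derivative_linear)
      have "?F' (x + t *\<^sub>R (y - x)) (y - x) =
          ?F' (x + t *\<^sub>R (y - x)) (\<Sum>b\<in>Basis. ((y - x) \<bullet> b) *\<^sub>R b)"
        by (simp only: euclidean_representation)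
      also have "\<dots> = (\<Sum>b\<in>Basis. ((y - x) \<bullet> b) * ?F' (x + t *\<^sub>R (y - x)) b)"
        by (simp only: linear_sum[OF l] linear_cmul[OF l] real_scaleR_def)
      finally show "?F' (x + t *\<^sub>R (y - x)) (y - x) =
          (\<Sum>b\<in>Basis. ((y - x) \<bullet> b) * ?F' (x + t *\<^sub>R (y - x)) b)" .
    qed
    also have "\<dots> = (\<Sum>b\<in>Basis. ((y - x) \<bullet> b) * ?G b y)"
      by (subst integral_sum)
        (auto intro!: integrable_continuous_interval continuous_intros c)
    finally show ?thesis .
  qed
qed

section \<open>Derivations as directional derivatives\<close>

lemma smooth_on_const: "smooth_on U (\<lambda>_. c)"
  by (simp add: smooth_on_def Ck_on_const)

lemma smooth_on_mult: "smooth_on U f \<Longrightarrow> smooth_on U g \<Longrightarrow> smooth_on U (\<lambda>x. f x * g x)"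
  by (simp add: smooth_on_def Ck_on_mult)

lemma smooth_on_cong: "open U \<Longrightarrow> smooth_on U f \<Longrightarrow> (\<And>x. x \<in> U \<Longrightarrow> f x = g x) \<Longrightarrow> smooth_on U g"
  unfolding smooth_on_def using Ck_on_cong[of U f g] by simp

lemma smooth_on_local:
  assumes "open U" "\<And>x. x \<in> U \<Longrightarrow> \<exists>V. open V \<and> x \<in> V \<and> smooth_on V f"
  shows "smooth_on U f"
  unfolding smooth_on_def
proof
  fix k show "Ck_on k U f"
    by (rule Ck_on_local[OF assms(1)]) (use assms(2) in \<open>force simp: smooth_on_def\<close>)
qed

lemma funs_open_imp_smooth_on:
  assumes "open U" "f \<in> funs (submfd U)"
  shows "smooth_on U f"
proof (rule smooth_on_local[OF assms(1)])
  fix x assume "x \<in> U"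
  then obtain V F where V: "open V" "x \<in> V" "smooth_on V F" "\<forall>y\<in>V \<inter> U. f y = F y"
    using assms(2) unfolding mem_funs_submfd_iff by blast
  have "smooth_on (V \<inter> U) f"
    by (rule smooth_on_cong[OF _ smooth_on_subset[OF V(3)]]) (use V assms(1) in auto)
  with V \<open>x \<in> U\<close> assms(1) show "\<exists>V. open V \<and> x \<in> V \<and> smooth_on V f"
    by (intro exI[of _ "V \<inter> U"]) auto
qed

lemma smooth_on_inner_right: "smooth_on U (\<lambda>y. y \<bullet> b)"
  by (simp add: smooth_on_def Ck_on_linear bounded_linear_inner_left)

lemma tangent_space_add: "D \<in> tangent_space X x \<Longrightarrow> f \<in> funs X \<Longrightarrow> h \<in> funs X \<Longrightarrow>
    D (\<lambda>y. f y + h y) = D f + D h"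
  and tangent_space_cmult: "D \<in> tangent_space X x \<Longrightarrow> f \<in> funs X \<Longrightarrow> D (\<lambda>y. c * f y) = c * D f"
  and tangent_space_mult: "D \<in> tangent_space X x \<Longrightarrow> f \<in> funs X \<Longrightarrow> h \<in> funs X \<Longrightarrow>
    D (\<lambda>y. f y * h y) = f x * D h + h x * D f"
  and tangent_space_off: "D \<in> tangent_space X x \<Longrightarrow> f \<notin> funs X \<Longrightarrow> D f = 0"
  unfolding tangent_space_def by blast+

lemma funs_const: "(\<lambda>_. c) \<in> funs (submfd S)"
  using smooth_vec_const[of S c] by (simp only: smooth_vec_real_iff)

lemma funs_add: "f \<in> funs (submfd S) \<Longrightarrow> g \<in> funs (submfd S) \<Longrightarrow> (\<lambda>x. f x + g x) \<in> funs (submfd S)"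
  using smooth_vec_add[of S f g] by (simp only: smooth_vec_real_iff)

lemma funs_sum: "(\<And>i. i \<in> I \<Longrightarrow> f i \<in> funs (submfd S)) \<Longrightarrow> (\<lambda>x. \<Sum>i\<in>I. f i x) \<in> funs (submfd S)"
  using smooth_vec_sum[of I S f] by (simp only: smooth_vec_real_iff)

lemma funs_inner: "(\<lambda>y. y \<bullet> b) \<in> funs (submfd S)"
  by (rule smooth_on_imp_funs[OF open_UNIV smooth_on_inner_right]) simp

lemma tangent_space_const:
  assumes D: "D \<in> tangent_space (submfd S) x"
  shows "D (\<lambda>_. c) = 0"
proof -
  have "D (\<lambda>y. 1 * 1) = 1 * D (\<lambda>_. 1) + 1 * D (\<lambda>_. 1)"
    by (rule tangent_space_mult[OF D]) (rule funs_const)+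
  then have "D (\<lambda>_. 1) = 0" by simp
  with tangent_space_cmult[OF D funs_const, of c 1] show ?thesis by simp
qed

lemma tangent_space_sum:
  assumes D: "D \<in> tangent_space (submfd S) x" and f: "\<And>i. i \<in> I \<Longrightarrow> f i \<in> funs (submfd S)"
  shows "D (\<lambda>y. \<Sum>i\<in>I. f i y) = (\<Sum>i\<in>I. D (f i))"
  using f
proof (induction I rule: infinite_finite_induct)
  case (insert i I)
  have "D (\<lambda>y. f i y + (\<Sum>j\<in>I. f j y)) = D (f i) + D (\<lambda>y. \<Sum>j\<in>I. f j y)"
    by (rule tangent_space_add[OF D]) (use insert.prems in \<open>auto intro: funs_sum\<close>)
  with insert show ?case by simp
qed (simp_all add: tangent_space_const[OF D])

text \<open>
  Since values off \<open>S\<close> do not matter for membership in \<open>funs\<close>, the indicator function of the complement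
  of \<open>S\<close> is smooth. The difference \<open>g - f\<close> equals its product with this function, and both
  factors vanish at \<open>x\<close>, so the Leibniz rule annihilates it.
\<close>

lemma tangent_space_cong:
  assumes D: "D \<in> tangent_space (submfd S) x" and x: "x \<in> S"
    and f: "f \<in> funs (submfd S)" and eq: "\<And>y. y \<in> S \<Longrightarrow> f y = g y"
  shows "D f = D g"
proof -
  let ?d = "\<lambda>y. g y - f y" and ?i = "\<lambda>y. if y \<in> S then 0 else (1::real)"
  have d: "?d \<in> funs (submfd S)" and i: "?i \<in> funs (submfd S)"
    by (rule funs_cong[OF funs_const[of 0]]; simp add: eq)+
  have "?d = (\<lambda>y. ?d y * ?i y)" by (rule ext) (simp add: eq)
  then have "D ?d = D (\<lambda>y. ?d y * ?i y)" by simp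
  also have "\<dots> = 0" using tangent_space_mult[OF D d i] x by (simp add: eq)
  finally have "D (\<lambda>y. f y + ?d y) = D f" using tangent_space_add[OF D f d] by simp
  then show ?thesis by simp
qed

lemma smooth_bump:
  fixes x :: "'a::euclidean_space"
  assumes "r > 0"
  obtains \<phi> where "smooth_on UNIV \<phi>" "\<phi> x \<noteq> (0::real)" "\<And>y. r \<le> dist x y \<Longrightarrow> \<phi> y = 0"
proof
  let ?\<phi> = "\<lambda>y. flat_exp 0 (r\<^sup>2 - (y - x) \<bullet> (y - x))"
  have q: "smooth_vec UNIV (\<lambda>y. r\<^sup>2 - (y - x) \<bullet> (y - x))"
    by (intro smooth_vec_diff smooth_vec_inner smooth_vec_const smooth_vec_id)
  have "flat_exp 0 \<in> funs (submfd UNIV)"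
    by (rule smooth_on_imp_funs[OF open_UNIV]) (simp_all add: smooth_on_def Ck_on_flat_exp)
  from funs_compose[OF q _ this] show "smooth_on UNIV ?\<phi>"
    by (simp add: funs_open_imp_smooth_on)
  show "?\<phi> x \<noteq> 0" using assms by (simp add: flat_exp_def)
  show "?\<phi> y = 0" if "r \<le> dist x y" for y
  proof -
    have "r\<^sup>2 \<le> (dist y x)\<^sup>2" using that assms by (intro power_mono) (auto simp: dist_commute)
    then show ?thesis by (simp add: flat_exp_def dist_norm power2_norm_eq_inner)
  qed
qed

text \<open>
  By Hadamard's lemma \<open>f - f x\<close> is near \<open>x\<close> a sum of products of the functions \<open>y \<bullet> b - x \<bullet> b\<close> with
  smooth functions. Multiplication with a bump function makes this identity global on \<open>S\<close>, and
  the Leibniz rule evaluates \<open>D\<close> on both sides.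
\<close>

lemma derivation_eq_frechet:
  fixes S :: "'a::euclidean_space set"
  assumes D: "D \<in> tangent_space (submfd S) x" and x: "x \<in> S" and f: "f \<in> funs (submfd S)"
    and U: "open U" "x \<in> U" "smooth_on U F" and eq: "\<And>y. y \<in> U \<inter> S \<Longrightarrow> f y = F y"
  shows "D f = frechet_derivative F (at x) (ambient_vector D)"
proof -
  obtain r where r: "r > 0" "ball x r \<subseteq> U" using U openE by blast
  obtain G where G: "\<And>b. smooth_on (ball x r) (G b)" "\<And>b. G b x = frechet_derivative F (at x) b"
    "\<And>y. y \<in> ball x r \<Longrightarrow> F y - F x = (\<Sum>b\<in>Basis. ((y - x) \<bullet> b) * G b y)"
    using hadamard[OF smooth_on_subset[OF U(3) r(2)]] r(1) by metis
  \<comment> \<open>half the radius, so that \<open>\<phi>\<close> times \<open>G b\<close> extends smoothly by 0\<close>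
  obtain \<phi> where \<phi>: "smooth_on UNIV \<phi>" "\<phi> x \<noteq> 0" "\<And>y. r/2 \<le> dist x y \<Longrightarrow> \<phi> y = 0"
    using smooth_bump[of "r/2" x] r(1) by auto
  define H where "H b y = (if y \<in> ball x r then \<phi> y * G b y else 0)" for b y
  have "smooth_on UNIV (H b)" for b
  proof (rule smooth_on_local[OF open_UNIV])
    fix y
    show "\<exists>V. open V \<and> y \<in> V \<and> smooth_on V (H b)"
    proof (cases "y \<in> ball x r")
      case True
      have "smooth_on (ball x r) (H b)"
        by (rule smooth_on_cong[OF open_ball smooth_on_mult[OF smooth_on_subset[OF \<phi>(1)] G(1)[of b]]])
          (simp_all add: H_def)
      with True show ?thesis by (intro exI[of _ "ball x r"]) simp
    next
      case False
      have "smooth_on (- cball x (r/2)) (H b)"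
        by (rule smooth_on_cong[OF _ smooth_on_const[of _ 0]]) (auto simp: H_def \<phi>(3))
      with False r(1) show ?thesis by (intro exI[of _ "- cball x (r/2)"]) auto
    qed
  qed
  then have H: "H b \<in> funs (submfd S)" for b
    by (rule smooth_on_imp_funs[OF open_UNIV]) simp
  have \<phi>f: "\<phi> \<in> funs (submfd S)" by (rule smooth_on_imp_funs[OF open_UNIV \<phi>(1)]) simp
  have fx: "(\<lambda>y. f y + - f x) \<in> funs (submfd S)" by (intro funs_add f funs_const)
  have yb: "(\<lambda>y. y \<bullet> b + - (x \<bullet> b)) \<in> funs (submfd S)" for b by (intro funs_add funs_inner funs_const)
  have eqS: "\<phi> y * (f y + - f x) = (\<Sum>b\<in>Basis. (y \<bullet> b + - (x \<bullet> b)) * H b y)" if y: "y \<in> S" for y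
  proof (cases "y \<in> ball x r")
    case True
    then have "f y + - f x = F y - F x" using eq U(2) r(2) x y by auto
    also have "\<dots> = (\<Sum>b\<in>Basis. ((y - x) \<bullet> b) * G b y)" using G(3) True by blast
    finally show ?thesis using True
      by (simp add: H_def sum_distrib_left inner_diff_left mult.left_commute)
  next
    case False
    then show ?thesis using r(1) by (simp add: H_def \<phi>(3))
  qed
  have "\<phi> x * D f = D (\<lambda>y. \<phi> y * (f y + - f x))"
    using tangent_space_mult[OF D \<phi>f fx] tangent_space_add[OF D f funs_const, of "- f x"]
    by (simp add: tangent_space_const[OF D])
  also have "\<dots> = D (\<lambda>y. \<Sum>b\<in>Basis. (y \<bullet> b + - (x \<bullet> b)) * H b y)"
    by (rule tangent_space_cong[OF D x funs_mult[OF \<phi>f fx] eqS])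
  also have "\<dots> = (\<Sum>b\<in>Basis. D (\<lambda>y. (y \<bullet> b + - (x \<bullet> b)) * H b y))"
    by (rule tangent_space_sum[OF D funs_mult[OF yb H]])
  also have "\<dots> = (\<Sum>b\<in>Basis. \<phi> x * (G b x * D (\<lambda>y. y \<bullet> b)))"
  proof (rule sum.cong[OF refl])
    fix b :: 'a
    show "D (\<lambda>y. (y \<bullet> b + - (x \<bullet> b)) * H b y) = \<phi> x * (G b x * D (\<lambda>y. y \<bullet> b))"
      using tangent_space_mult[OF D yb H, of b b] r(1)
        tangent_space_add[OF D funs_inner funs_const, of b "- (x \<bullet> b)"]
      by (simp add: tangent_space_const[OF D] H_def)
  qed
  also have "\<dots> = \<phi> x * frechet_derivative F (at x) (ambient_vector D)"
  proof -
    have l: "linear (frechet_derivative F (at x))"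
      by (rule has_derivative_linear[OF smooth_on_imp_frechet(1)[OF U(1,3,2)]])
    show ?thesis
      by (simp add: ambient_vector_def linear_sum[OF l] linear_cmul[OF l] G(2) sum_distrib_left
          mult.commute)
  qed
  finally show ?thesis using \<phi>(2) by simp
qed

section \<open>Tangent vectors and metrics on spheres\<close>

abbreviation unit_sphere :: "'a::euclidean_space set"
  where "unit_sphere \<equiv> sphere 0 1"

text \<open>
  Extending a function on the sphere radially, by \<open>f (sgn y)\<close>, gives one smooth function on
  the complement of the origin, so that no choice of a local extension is needed.
\<close>

definition sphere_tvec :: "'a::euclidean_space \<Rightarrow> 'a \<Rightarrow> 'a tvec"
  where "sphere_tvec x v = (\<lambda>f. if f \<in> funs (submfd unit_sphere)
    then frechet_derivative (\<lambda>y. f (sgn y)) (at x) v else 0)"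

lemma smooth_vec_sgn: "smooth_vec (- {0}) (sgn :: 'a::euclidean_space \<Rightarrow> 'a)"
proof -
  have "smooth_vec (- {0}) (\<lambda>y::'a. inverse (sqrt (y \<bullet> y)) *\<^sub>R y)"
    by (intro smooth_vec_scaleR smooth_vec_inverse smooth_vec_sqrt smooth_vec_inner smooth_vec_id)
      auto
  then show ?thesis by (rule smooth_vec_cong) (simp add: sgn_div_norm norm_eq_sqrt_inner)
qed

lemma smooth_on_radial:
  assumes "f \<in> funs (submfd unit_sphere)"
  shows "smooth_on (- {0}) (\<lambda>y. f (sgn y))"
  by (rule funs_open_imp_smooth_on[OF _ funs_compose[OF smooth_vec_sgn _ assms]])
    (auto simp: norm_sgn split: if_splits)

lemma sphere_tvec_has_derivative:
  assumes "f \<in> funs (submfd unit_sphere)" "x \<in> unit_sphere"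
  shows "((\<lambda>y. f (sgn y)) has_derivative (\<lambda>v. sphere_tvec x v f)) (at x)"
proof -
  have "x \<in> - {0}" using assms(2) by auto
  from smooth_on_imp_frechet(1)[OF open_Compl[OF closed_singleton] smooth_on_radial[OF assms(1)] this]
  show ?thesis using assms(1) by (simp add: sphere_tvec_def)
qed

lemma sphere_tvec_in_tangent_space:
  assumes x: "x \<in> unit_sphere"
  shows "sphere_tvec x v \<in> tangent_space (submfd unit_sphere) x"
proof -
  have [simp]: "sgn x = x" using x by (simp add: sgn_div_norm)
  note d = sphere_tvec_has_derivative[OF _ x]
  have u: "sphere_tvec x v h = g v"
    if "h \<in> funs (submfd unit_sphere)" "((\<lambda>y. h (sgn y)) has_derivative g) (at x)" for h g
    using fun_cong[OF has_derivative_unique[OF d[OF that(1)] that(2)], of v] .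
  show ?thesis
    unfolding tangent_space_def
  proof (intro CollectI conjI allI ballI impI)
    show "sphere_tvec x v f = 0" if "f \<notin> funs (submfd unit_sphere)" for f
      using that by (simp add: sphere_tvec_def)
  next
    fix f c assume f: "f \<in> funs (submfd (unit_sphere :: 'a set))"
    show "sphere_tvec x v (\<lambda>y. c * f y) = c * sphere_tvec x v f"
      by (rule u[OF funs_mult[OF funs_const f]]) (rule has_derivative_mult_right[OF d[OF f]])
  next
    fix f h assume f: "f \<in> funs (submfd (unit_sphere :: 'a set))"
      and h: "h \<in> funs (submfd (unit_sphere :: 'a set))"
    show "sphere_tvec x v (\<lambda>y. f y + h y) = sphere_tvec x v f + sphere_tvec x v h"
      by (rule u[OF funs_add[OF f h]]) (rule has_derivative_add[OF d[OF f] d[OF h]])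
    have "sphere_tvec x v (\<lambda>y. f y * h y) = f (sgn x) * sphere_tvec x v h + sphere_tvec x v f * h (sgn x)"
      by (rule u[OF funs_mult[OF f h]]) (rule has_derivative_mult[OF d[OF f] d[OF h]])
    then show "sphere_tvec x v (\<lambda>y. f y * h y) = f x * sphere_tvec x v h + h x * sphere_tvec x v f"
      by simp
  qed
qed

lemma ambient_vector_inner: "b \<in> Basis \<Longrightarrow> ambient_vector D \<bullet> b = D (\<lambda>y. y \<bullet> b)"
  by (simp add: ambient_vector_def)

lemma ambient_vector_sphere_tvec:
  assumes x: "x \<in> unit_sphere" and v: "x \<bullet> v = 0"
  shows "ambient_vector (sphere_tvec x v) = v"
proof (rule euclidean_eqI)
  fix b :: 'a assume b: "b \<in> Basis"
  have nx: "norm x = 1" "x \<noteq> 0" "sgn x = x" using x by (auto simp: sgn_div_norm)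
  have "((\<lambda>y. inverse (norm y)) has_derivative
      (\<lambda>v. - (inverse (norm x) * (v \<bullet> sgn x) * inverse (norm x)))) (at x)"
    by (rule Deriv.has_derivative_inverse[OF _ has_derivative_norm]) (use nx in auto)
  from has_derivative_mult[OF has_derivative_inner_left[OF has_derivative_ident] this]
  have "((\<lambda>y. (y \<bullet> b) * inverse (norm y)) has_derivative
      (\<lambda>v. (x \<bullet> b) * - (inverse (norm x) * (v \<bullet> sgn x) * inverse (norm x)) + (v \<bullet> b) * inverse (norm x))) (at x)" .
  then have "((\<lambda>y. sgn y \<bullet> b) has_derivative (\<lambda>v. v \<bullet> b - (x \<bullet> b) * (v \<bullet> x))) (at x)"
    by (simp add: sgn_div_norm nx mult.commute algebra_simps)
  from fun_cong[OF has_derivative_unique[OF sphere_tvec_has_derivative[OF funs_inner x] this], of v]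
  show "ambient_vector (sphere_tvec x v) \<bullet> b = v \<bullet> b"
    using v by (simp add: ambient_vector_inner[OF b] inner_commute[of v x])
qed

text \<open>
  Orthogonality to \<open>x\<close> comes from applying the derivation to the function \<open>y \<bullet> y\<close>, which is constant
  on the sphere.
\<close>

lemma tangent_vector_sphere:
  assumes D: "D \<in> tangent_space (submfd unit_sphere) x" and x: "x \<in> unit_sphere"
  shows "x \<bullet> ambient_vector D = 0" and "D = sphere_tvec x (ambient_vector D)"
proof -
  have "0 = D (\<lambda>_. 1)" by (simp add: tangent_space_const[OF D])
  also have "\<dots> = D (\<lambda>y. \<Sum>b\<in>Basis. (y \<bullet> b) * (y \<bullet> b))"
    by (rule tangent_space_cong[OF D x funs_const])
      (simp add: euclidean_inner[symmetric] power2_norm_eq_inner[symmetric])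
  also have "\<dots> = (\<Sum>b\<in>Basis. D (\<lambda>y. (y \<bullet> b) * (y \<bullet> b)))"
    by (rule tangent_space_sum[OF D funs_mult[OF funs_inner funs_inner]])
  also have "\<dots> = (\<Sum>b\<in>Basis. 2 * ((x \<bullet> b) * (ambient_vector D \<bullet> b)))"
    by (rule sum.cong[OF refl])
      (simp add: tangent_space_mult[OF D funs_inner funs_inner] ambient_vector_inner)
  also have "\<dots> = 2 * (x \<bullet> ambient_vector D)"
    by (simp add: euclidean_inner[of x "ambient_vector D"] sum_distrib_left)
  finally show "x \<bullet> ambient_vector D = 0" by simp
  show "D = sphere_tvec x (ambient_vector D)"
  proof
    fix f
    show "D f = sphere_tvec x (ambient_vector D) f"
    proof (cases "f \<in> funs (submfd (unit_sphere :: 'a set))")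
      case True
      have "D f = frechet_derivative (\<lambda>y. f (sgn y)) (at x) (ambient_vector D)"
        by (rule derivation_eq_frechet[OF D x True _ _ smooth_on_radial[OF True]])
          (use x in \<open>auto simp: sgn_div_norm\<close>)
      with True show ?thesis by (simp add: sphere_tvec_def)
    next
      case False
      with tangent_space_off[OF D] show ?thesis by (simp add: sphere_tvec_def)
    qed
  qed
qed

lemma smooth_vector_field_sphere:
  assumes "smooth_vec unit_sphere W"
  shows "smooth_vector_field (submfd unit_sphere) (\<lambda>x. sphere_tvec x (W x))"
  unfolding smooth_vector_field_def
proof (intro conjI ballI)
  show "sphere_tvec x (W x) \<in> tangent_space (submfd unit_sphere) x"
    if "x \<in> points (submfd unit_sphere)" for x
    using that by (simp add: sphere_tvec_in_tangent_space)
  fix f assume f: "f \<in> funs (submfd (unit_sphere :: 'a set))"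
  let ?F = "\<lambda>y. f (sgn y)"
  have "(\<lambda>x. frechet_derivative ?F (at x) b) \<in> funs (submfd unit_sphere)" for b
    by (rule smooth_on_imp_funs[OF _ smooth_on_imp_frechet(2)[OF _ smooth_on_radial[OF f]]]) auto
  moreover have "(\<lambda>x. W x \<bullet> b) \<in> funs (submfd unit_sphere)" for b
    using smooth_vec_linear_comp[OF bounded_linear_inner_left assms] by (simp add: smooth_vec_real_iff)
  ultimately have "(\<lambda>x. \<Sum>b\<in>Basis. (W x \<bullet> b) * frechet_derivative ?F (at x) b) \<in> funs (submfd unit_sphere)"
    by (intro funs_sum funs_mult)
  then show "(\<lambda>x. sphere_tvec x (W x) f) \<in> funs (submfd unit_sphere)"
  proof (rule funs_cong)
    fix x :: 'a assume x: "x \<in> unit_sphere"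
    have l: "linear (\<lambda>v. sphere_tvec x v f)"
      by (rule has_derivative_linear[OF sphere_tvec_has_derivative[OF f x]])
    have "sphere_tvec x (W x) f = sphere_tvec x (\<Sum>b\<in>Basis. (W x \<bullet> b) *\<^sub>R b) f"
      by (simp only: euclidean_representation)
    also have "\<dots> = (\<Sum>b\<in>Basis. (W x \<bullet> b) * sphere_tvec x b f)"
      by (simp only: linear_sum[OF l] linear_cmul[OF l] real_scaleR_def)
    finally show "(\<Sum>b\<in>Basis. (W x \<bullet> b) * frechet_derivative ?F (at x) b) = sphere_tvec x (W x) f"
      using f by (simp add: sphere_tvec_def)
  qed
qed

lemma tangent_space_closed:
  assumes D: "D \<in> tangent_space X x" and E: "E \<in> tangent_space X x"
  shows tangent_space_plus: "(\<lambda>f. D f + E f) \<in> tangent_space X x"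
    and tangent_space_scale: "(\<lambda>f. c * D f) \<in> tangent_space X x"
  using assms unfolding tangent_space_def by (simp_all add: algebra_simps)

lemma tangent_space_zero: "(\<lambda>_. 0) \<in> tangent_space X x"
  by (simp add: tangent_space_def)

lemma tangent_space_lincomb:
  "(\<And>i. i \<in> I \<Longrightarrow> D i \<in> tangent_space X x) \<Longrightarrow> (\<lambda>f. \<Sum>i\<in>I. c i * D i f) \<in> tangent_space X x"
proof (induction I rule: infinite_finite_induct)
  case (insert i I)
  then show ?case
    using tangent_space_plus[OF tangent_space_scale[of "D i" X x "D i" "c i"], of "\<lambda>f. \<Sum>i\<in>I. c i * D i f"]
    by simp
qed (simp_all add: tangent_space_zero)

lemma riemannian_metricD:
  assumes "riemannian_metric X g" "x \<in> points X" "D \<in> tangent_space X x" "E \<in> tangent_space X x"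
  shows riemannian_metric_sym: "g x D E = g x E D"
    and riemannian_metric_add: "F \<in> tangent_space X x \<Longrightarrow> g x (\<lambda>f. D f + E f) F = g x D F + g x E F"
    and riemannian_metric_scale: "g x (\<lambda>f. c * D f) E = c * g x D E"
    and riemannian_metric_pos: "D \<noteq> (\<lambda>_. 0) \<Longrightarrow> g x D D > 0"
  using assms unfolding riemannian_metric_def by blast+

lemma riemannian_metric_zero:
  "riemannian_metric X g \<Longrightarrow> x \<in> points X \<Longrightarrow> E \<in> tangent_space X x \<Longrightarrow> g x (\<lambda>_. 0) E = 0"
  using riemannian_metric_scale[OF _ _ tangent_space_zero, of X g x E 0] by simp

lemma riemannian_metric_lincomb:
  assumes g: "riemannian_metric X g" and x: "x \<in> points X"
    and D: "\<And>i. i \<in> I \<Longrightarrow> D i \<in> tangent_space X x" and E: "E \<in> tangent_space X x"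
  shows "g x (\<lambda>f. \<Sum>i\<in>I. c i * D i f) E = (\<Sum>i\<in>I. c i * g x (D i) E)"
  using D
proof (induction I rule: infinite_finite_induct)
  case (insert i I)
  have Di: "D i \<in> tangent_space X x" by (simp add: insert.prems)
  have l: "(\<lambda>f. \<Sum>i\<in>I. c i * D i f) \<in> tangent_space X x"
    by (rule tangent_space_lincomb) (simp add: insert.prems)
  show ?case
    using insert riemannian_metric_add[OF g x tangent_space_scale[OF Di Di] l E, of "c i"]
      riemannian_metric_scale[OF g x Di E] by simp
qed (simp_all add: riemannian_metric_zero[OF g x E])

text \<open>
  Smoothness of a metric only concerns pairs of global vector fields. The projections of
  the constant fields \<open>b\<close> to the sphere are smooth fields that span every tangent space, and
  a vector \<open>v\<close> orthogonal to \<open>x\<close> has with respect to them the same coefficients \<open>v \<bullet> b\<close> as in the ambient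
  space. So the values of the metric on these fields are the coefficients of the quadratic form.
\<close>

lemma riemannian_metric_smooth_quadratic:
  fixes g :: "'a::euclidean_space metric"
  assumes g: "riemannian_metric (submfd unit_sphere) g"
  obtains q where "\<And>b c. q b c \<in> funs (submfd unit_sphere)"
    and "\<And>x v. x \<in> unit_sphere \<Longrightarrow> x \<bullet> v = 0 \<Longrightarrow>
      g x (sphere_tvec x v) (sphere_tvec x v) = (\<Sum>b\<in>Basis. \<Sum>c\<in>Basis. (v \<bullet> b) * ((v \<bullet> c) * q b c x))"
proof
  define V where "V b x = sphere_tvec x (b - (x \<bullet> b) *\<^sub>R x)" for b x :: 'a
  have VF: "smooth_vector_field (submfd unit_sphere) (V b)" for b
    unfolding V_def
    by (intro smooth_vector_field_sphere smooth_vec_diff smooth_vec_const smooth_vec_scaleR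
        smooth_vec_inner smooth_vec_id)
  show "(\<lambda>x. g x (V b x) (V c x)) \<in> funs (submfd unit_sphere)" for b c
    using g VF unfolding riemannian_metric_def by blast
  fix x v :: 'a assume x: "x \<in> unit_sphere" and v: "x \<bullet> v = 0"
  have VT: "V b x \<in> tangent_space (submfd unit_sphere) x" for b
    unfolding V_def using x by (rule sphere_tvec_in_tangent_space)
  have ST: "sphere_tvec x v \<in> tangent_space (submfd unit_sphere) x"
    using x by (rule sphere_tvec_in_tangent_space)
  have xp: "x \<in> points (submfd unit_sphere)" using x by simp
  have e: "sphere_tvec x v = (\<lambda>f. \<Sum>b\<in>Basis. (v \<bullet> b) * V b x f)"
  proof
    fix f
    show "sphere_tvec x v f = (\<Sum>b\<in>Basis. (v \<bullet> b) * V b x f)"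
    proof (cases "f \<in> funs (submfd (unit_sphere :: 'a set))")
      case True
      have l: "linear (\<lambda>v. sphere_tvec x v f)"
        by (rule has_derivative_linear[OF sphere_tvec_has_derivative[OF True x]])
      have "(\<Sum>b\<in>Basis. (v \<bullet> b) *\<^sub>R (b - (x \<bullet> b) *\<^sub>R x)) =
          (\<Sum>b\<in>Basis. (v \<bullet> b) *\<^sub>R b) - (\<Sum>b\<in>Basis. (v \<bullet> b) * (x \<bullet> b)) *\<^sub>R x"
        by (simp add: scaleR_diff_right sum_subtractf scaleR_sum_left)
      also have "\<dots> = v"
        by (simp only: euclidean_inner[symmetric] inner_commute[of v x] v euclidean_representation)
          simp
      finally have "sphere_tvec x v f = sphere_tvec x (\<Sum>b\<in>Basis. (v \<bullet> b) *\<^sub>R (b - (x \<bullet> b) *\<^sub>R x)) f"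
        by simp
      also have "\<dots> = (\<Sum>b\<in>Basis. (v \<bullet> b) * V b x f)"
        by (simp only: linear_sum[OF l] linear_cmul[OF l] real_scaleR_def V_def)
      finally show ?thesis .
    next
      case False
      then show ?thesis by (simp add: V_def sphere_tvec_def)
    qed
  qed
  have "g x (sphere_tvec x v) (sphere_tvec x v) = (\<Sum>b\<in>Basis. (v \<bullet> b) * g x (V b x) (sphere_tvec x v))"
    by (subst e) (rule riemannian_metric_lincomb[OF g xp VT ST])
  also have "\<dots> = (\<Sum>b\<in>Basis. (v \<bullet> b) * g x (sphere_tvec x v) (V b x))"
    using riemannian_metric_sym[OF g xp VT ST] by simp
  also have "\<dots> = (\<Sum>b\<in>Basis. (v \<bullet> b) * (\<Sum>c\<in>Basis. (v \<bullet> c) * g x (V c x) (V b x)))"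
    by (subst e) (simp only: riemannian_metric_lincomb[OF g xp VT VT])
  also have "\<dots> = (\<Sum>b\<in>Basis. \<Sum>c\<in>Basis. (v \<bullet> b) * ((v \<bullet> c) * g x (V b x) (V c x)))"
    using riemannian_metric_sym[OF g xp VT VT] by (simp add: sum_distrib_left)
  finally show "g x (sphere_tvec x v) (sphere_tvec x v) =
      (\<Sum>b\<in>Basis. \<Sum>c\<in>Basis. (v \<bullet> b) * ((v \<bullet> c) * g x (V b x) (V c x)))" .
qed

lemma unit_tangent_bundle_sphere:
  "unit_tangent_bundle unit_sphere g =
    submfd {(x, v). x \<in> unit_sphere \<and> x \<bullet> v = 0 \<and> g x (sphere_tvec x v) (sphere_tvec x v) = 1}"
proof -
  have "{(x, ambient_vector D) | x D. x \<in> unit_sphere \<and>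
      D \<in> tangent_space (submfd (unit_sphere::'a set)) x \<and> g x D D = 1} =
    {(x, v). x \<in> unit_sphere \<and> x \<bullet> v = 0 \<and> g x (sphere_tvec x v) (sphere_tvec x v) = 1}"
    (is "?A = ?B")
  proof
    show "?A \<subseteq> ?B"
    proof
      fix z assume "z \<in> ?A"
      then obtain x D where z: "z = (x, ambient_vector D)" and x: "x \<in> unit_sphere"
        and D: "D \<in> tangent_space (submfd unit_sphere) x" "g x D D = 1" by blast
      show "z \<in> ?B"
        using tangent_vector_sphere(1)[OF D(1) x] tangent_vector_sphere(2)[OF D(1) x, symmetric] x D(2)
        by (simp add: z)
    qed
    show "?B \<subseteq> ?A"
    proof
      fix z assume "z \<in> ?B"
      then obtain x v where z: "z = (x, v)" "x \<in> unit_sphere" "x \<bullet> v = 0"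
        "g x (sphere_tvec x v) (sphere_tvec x v) = 1" by blast
      then have "z = (x, ambient_vector (sphere_tvec x v))"
        by (simp add: ambient_vector_sphere_tvec)
      with z sphere_tvec_in_tangent_space show "z \<in> ?A" by blast
    qed
  qed
  then show ?thesis by (simp add: unit_tangent_bundle_def)
qed

lemma unit_tangent_bundle_sphere_induced:
  "unit_tangent_bundle unit_sphere induced_metric =
    submfd {(x, v). x \<in> unit_sphere \<and> x \<bullet> v = 0 \<and> v \<in> (unit_sphere :: 'a::euclidean_space set)}"
  unfolding unit_tangent_bundle_sphere
  by (rule arg_cong[where f=submfd])
    (auto simp: induced_metric_def ambient_vector_sphere_tvec norm_eq_1)

lemma unit_tangent_bundles_isomorphic:
  fixes g :: "'a::euclidean_space metric"
  assumes g: "riemannian_metric (submfd unit_sphere) g"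
  obtains \<Psi> where "diffeomorphism (unit_tangent_bundle unit_sphere induced_metric)
      (unit_tangent_bundle unit_sphere g) \<Psi>" "\<And>z. fst (\<Psi> z) = fst z"
proof -
  obtain q where q: "\<And>b c. q b c \<in> funs (submfd unit_sphere)"
    and gq: "\<And>x v. x \<in> unit_sphere \<Longrightarrow> x \<bullet> v = 0 \<Longrightarrow>
      g x (sphere_tvec x v) (sphere_tvec x v) = (\<Sum>b\<in>Basis. \<Sum>c\<in>Basis. (v \<bullet> b) * ((v \<bullet> c) * q b c x))"
    using riemannian_metric_smooth_quadratic[OF g] by blast
  \<comment> \<open>\<open>N (x, v)\<close> is the square of the length of \<open>v\<close> in the metric \<open>g\<close>\<close>
  define N where "N z = (\<Sum>b\<in>Basis. \<Sum>c\<in>Basis. (snd z \<bullet> b) * ((snd z \<bullet> c) * q b c (fst z)))"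
    for z :: "'a \<times> 'a"
  define n where "n z = sqrt (N z)" for z
  let ?A = "{(x, v). x \<in> unit_sphere \<and> x \<bullet> v = 0 \<and> v \<in> (unit_sphere :: 'a set)}"
  let ?B = "{(x, v). x \<in> unit_sphere \<and> x \<bullet> v = 0 \<and> g x (sphere_tvec x v) (sphere_tvec x v) = 1}"
  define \<Psi> where "\<Psi> z = (fst z, inverse (n z) *\<^sub>R snd z)" for z :: "'a \<times> 'a"
  define \<Psi>' where "\<Psi>' z = (fst z, inverse (norm (snd z)) *\<^sub>R snd z)" for z :: "'a \<times> 'a"
  have gN: "g x (sphere_tvec x v) (sphere_tvec x v) = N (x, v)" if "x \<in> unit_sphere" "x \<bullet> v = 0" for x v
    using gq[OF that] by (simp add: N_def)
  have Npos: "N (x, v) > 0" if "x \<in> unit_sphere" "x \<bullet> v = 0" "v \<noteq> 0" for x v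
  proof -
    have "ambient_vector (sphere_tvec x v) \<noteq> 0" using that by (simp add: ambient_vector_sphere_tvec)
    then have "sphere_tvec x v \<noteq> (\<lambda>_. 0)" by (auto simp: ambient_vector_def)
    with riemannian_metric_pos[OF g _ sphere_tvec_in_tangent_space sphere_tvec_in_tangent_space, of x v]
    show ?thesis using that by (simp add: gN)
  qed
  have Nscale: "N (x, c *\<^sub>R v) = c\<^sup>2 * N (x, v)" for x v c
    by (simp add: N_def sum_distrib_left power2_eq_square algebra_simps)
  have nscale: "n (x, c *\<^sub>R v) = \<bar>c\<bar> * n (x, v)" for x v c
    by (simp add: n_def Nscale real_sqrt_mult)
  have npos: "n (x, v) > 0" if "x \<in> unit_sphere" "x \<bullet> v = 0" "v \<noteq> 0" for x v
    using Npos[OF that] by (simp add: n_def)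
  have v0: "v \<noteq> 0" if "(x, v) \<in> ?B" for x v
    using that by (auto simp: gN N_def)
  have nB: "n (x, v) = 1" if "(x, v) \<in> ?B" for x v
    using that by (auto simp: gN n_def)
  have qf: "smooth_vec S (\<lambda>z. q b c (fst z))" if "fst ` S \<subseteq> unit_sphere" for S b c
    using funs_compose[OF smooth_vec_bounded_linear[OF bounded_linear_fst] that q]
    by (simp add: smooth_vec_real_iff)
  have "smooth_vec ?A N"
    unfolding N_def
    by (intro smooth_vec_sum smooth_vec_mult smooth_vec_inner smooth_vec_const qf
        smooth_vec_bounded_linear[OF bounded_linear_snd]) auto
  then have "smooth_vec ?A \<Psi>" unfolding \<Psi>_def n_def
    by (intro smooth_vec_Pair smooth_vec_scaleR smooth_vec_inverse smooth_vec_sqrt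
        smooth_vec_bounded_linear[OF bounded_linear_snd] smooth_vec_bounded_linear[OF bounded_linear_fst])
      (use Npos in \<open>force+\<close>)
  moreover have "\<Psi> ` ?A \<subseteq> ?B"
  proof clarify
    fix x v x' v' assume *: "(x', v') = \<Psi> (x, v)" "x \<in> unit_sphere" "x \<bullet> v = 0" "v \<in> unit_sphere"
    then have "v \<noteq> 0" by auto
    with * have p: "n (x, v) > 0" using npos[of x v] by simp
    from p have "N (x, v) = (n (x, v))\<^sup>2" by (simp add: n_def)
    with p have "N (x, inverse (n (x, v)) *\<^sub>R v) = 1" by (simp add: Nscale power_inverse)
    with * show "x' \<in> unit_sphere \<and> x' \<bullet> v' = 0 \<and> g x' (sphere_tvec x' v') (sphere_tvec x' v') = 1"
      by (simp add: \<Psi>_def gN)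
  qed
  ultimately have 1: "smooth_map (submfd ?A) (submfd ?B) \<Psi>" by (rule smooth_vec_imp_smooth_map)
  have "smooth_vec ?B \<Psi>'" unfolding \<Psi>'_def norm_eq_sqrt_inner
    by (intro smooth_vec_Pair smooth_vec_scaleR smooth_vec_inverse smooth_vec_sqrt smooth_vec_inner
        smooth_vec_bounded_linear[OF bounded_linear_snd] smooth_vec_bounded_linear[OF bounded_linear_fst])
      (use v0 in \<open>force+\<close>)
  moreover have "\<Psi>' ` ?B \<subseteq> ?A"
    using v0 by (auto simp: \<Psi>'_def)
  ultimately have 2: "smooth_map (submfd ?B) (submfd ?A) \<Psi>'" by (rule smooth_vec_imp_smooth_map)
  have 3: "\<Psi>' (\<Psi> z) = z" if "z \<in> ?A" for z
  proof (cases z)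
    case (Pair x v)
    with that have "norm v = 1" "x \<in> unit_sphere" "x \<bullet> v = 0" "v \<noteq> 0" by auto
    with npos[of x v] have "norm v = 1" "n (x, v) > 0" by auto
    then show ?thesis by (simp add: Pair \<Psi>_def \<Psi>'_def)
  qed
  have 4: "\<Psi> (\<Psi>' z) = z" if "z \<in> ?B" for z
  proof (cases z)
    case (Pair x v)
    with that have "norm v > 0" "n (x, v) = 1" using v0[of x v] nB[of x v] by auto
    then show ?thesis by (simp add: Pair \<Psi>_def \<Psi>'_def nscale)
  qed
  show thesis
  proof
    show "diffeomorphism (unit_tangent_bundle unit_sphere induced_metric)
        (unit_tangent_bundle unit_sphere g) \<Psi>"
      unfolding unit_tangent_bundle_sphere_induced unit_tangent_bundle_sphere[of g]
      by (rule diffeomorphism_submfdI[OF 1 2 3 4])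
    show "fst (\<Psi> z) = fst z" for z by (simp add: \<Psi>_def)
  qed
qed

section \<open>Quaternions and quaternionic matrices\<close>

lemmas quat_ops = zero_quat_def one_quat_def plus_quat_def minus_quat_def uminus_quat_def
  times_quat_def scaleR_quat_def qcnj_def inner_quat_def

lemma quat_scaleR_mult [simp]:
  fixes x y :: quat
  shows "(r *\<^sub>R x) * y = r *\<^sub>R (x * y)" "x * (r *\<^sub>R y) = r *\<^sub>R (x * y)"
  by (simp_all add: quat_ops quat_eq_iff algebra_simps)

lemma bounded_bilinear_quat_mult: "bounded_bilinear ((*) :: quat \<Rightarrow> quat \<Rightarrow> quat)"
  unfolding bilinear_conv_bounded_bilinear[symmetric] bilinear_def
  by (auto intro!: linearI simp: algebra_simps)

lemma qcnj_mult: "qcnj (x * y) = qcnj y * qcnj x"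
  and qcnj_add: "qcnj (x + y) = qcnj x + qcnj y"
  and qcnj_uminus [simp]: "qcnj (- x) = - qcnj x"
  and qcnj_scaleR [simp]: "qcnj (r *\<^sub>R x) = r *\<^sub>R qcnj x"
  and qcnj_qcnj [simp]: "qcnj (qcnj x) = x"
  and qcnj_0 [simp]: "qcnj 0 = 0" and qcnj_1 [simp]: "qcnj 1 = 1"
  by (simp_all add: quat_ops quat_eq_iff algebra_simps)

lemma bounded_linear_qcnj: "bounded_linear qcnj"
  unfolding linear_conv_bounded_linear[symmetric] by (rule linearI) (simp_all add: qcnj_add)

lemma qcnj_mult_self: "qcnj x * x = (x \<bullet> x) *\<^sub>R 1" "x * qcnj x = (x \<bullet> x) *\<^sub>R 1"
  by (simp_all add: quat_ops quat_eq_iff algebra_simps)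

lemma qcnj_mult_sym: "qcnj x * y + qcnj y * x = (2 * (x \<bullet> y)) *\<^sub>R 1"
  by (simp_all add: quat_ops quat_eq_iff algebra_simps)

lemma inner_mult_left_quat: "(p * x) \<bullet> (p * y) = (p \<bullet> p) * (x \<bullet> y)" for p x y :: quat
  by (simp add: quat_ops algebra_simps)

lemma inner_qcnj [simp]: "qcnj x \<bullet> qcnj y = x \<bullet> y"
  by (simp add: quat_ops)

lemma qRe_mult_qcnj: "qRe (x * qcnj y) = x \<bullet> y"
  by (simp add: quat_ops)

lemma inner_one_quat [simp]: "(1::quat) \<bullet> 1 = 1"
  by (simp add: quat_ops)

lemma scaleR_one_quat_eq_iff: "a *\<^sub>R (1::quat) = b *\<^sub>R 1 \<longleftrightarrow> a = b"
  "a *\<^sub>R (1::quat) = 1 \<longleftrightarrow> a = 1"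
  by (simp_all add: quat_ops quat_eq_iff)

lemma quat_eq_minus_self: "x = - x \<Longrightarrow> x = 0" "- x = x \<Longrightarrow> x = 0" for x :: quat
  by (simp_all add: quat_ops quat_eq_iff)

lemma quat_add_self: "x + x = 0 \<Longrightarrow> x = 0" for x :: quat
  by (simp add: quat_ops quat_eq_iff)

lemma S3_iff: "p \<in> S3 \<longleftrightarrow> p \<bullet> p = 1"
  by (simp add: S3_def norm_eq_1)

definition qm :: "quat \<Rightarrow> quat \<Rightarrow> quat \<Rightarrow> quat \<Rightarrow> qmat"
  where "qm a b c d = vector [vector [a, b], vector [c, d]]"

lemma qm_nth [simp]: "qm a b c d $ 1 $ 1 = a" "qm a b c d $ 1 $ 2 = b"
  "qm a b c d $ 2 $ 1 = c" "qm a b c d $ 2 $ 2 = d"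
  by (simp_all add: qm_def)

lemma qmat_eq_iff: "A = B \<longleftrightarrow> A $ 1 $ 1 = B $ 1 $ 1 \<and> A $ 1 $ 2 = B $ 1 $ 2 \<and>
    A $ 2 $ 1 = B $ 2 $ 1 \<and> A $ 2 $ 2 = B $ 2 $ 2" for A B :: qmat
  by (auto simp: vec_eq_iff forall_2)

lemma qm_eq_iff [simp]: "qm a b c d = qm a' b' c' d' \<longleftrightarrow> a = a' \<and> b = b' \<and> c = c' \<and> d = d'"
  by (simp add: qmat_eq_iff)

lemma qmat_cases: obtains a b c d where "Q = qm a b c d"
  using that[of "Q $ 1 $ 1" "Q $ 1 $ 2" "Q $ 2 $ 1" "Q $ 2 $ 2"] by (simp add: qmat_eq_iff)

lemma qm_mult: "qm a b c d ** qm a' b' c' d' =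
    qm (a * a' + b * c') (a * b' + b * d') (c * a' + d * c') (c * b' + d * d')"
  by (simp add: qmat_eq_iff matrix_matrix_mult_def sum_2)

lemma qm_add: "qm a b c d + qm a' b' c' d' = qm (a + a') (b + b') (c + c') (d + d')"
  and qm_scaleR: "r *\<^sub>R qm a b c d = qm (r *\<^sub>R a) (r *\<^sub>R b) (r *\<^sub>R c) (r *\<^sub>R d)"
  and qadjoint_qm: "qadjoint (qm a b c d) = qm (qcnj a) (qcnj c) (qcnj b) (qcnj d)"
  by (simp_all add: qmat_eq_iff qadjoint_def)

lemma mat_1_qm: "(mat 1 :: qmat) = qm 1 0 0 1"
  by (simp add: qmat_eq_iff mat_def)

lemma qdiag_qm: "qdiag p q = qm p 0 0 q"
  by (simp add: qdiag_def qm_def)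

lemmas qm_ops = qm_mult qm_add qm_scaleR qadjoint_qm mat_1_qm qdiag_qm

lemma qadjoint_mult: "qadjoint (A ** B) = qadjoint B ** qadjoint A"
  by (cases A rule: qmat_cases; cases B rule: qmat_cases) (simp add: qm_ops qcnj_mult qcnj_add)

lemma qadjoint_qadjoint [simp]: "qadjoint (qadjoint A) = A"
  by (cases A rule: qmat_cases) (simp add: qm_ops)

lemma bounded_bilinear_qmat_mult: "bounded_bilinear ((**) :: qmat \<Rightarrow> qmat \<Rightarrow> qmat)"
proof -
  have "bilinear ((**) :: qmat \<Rightarrow> qmat \<Rightarrow> qmat)"
    unfolding bilinear_def
  proof (intro conjI allI linearI)
    fix A B C :: qmat and r
    show "A ** (B + C) = A ** B + A ** C" "(B + C) ** A = B ** A + C ** A"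
      "A ** (r *\<^sub>R B) = r *\<^sub>R (A ** B)" "(r *\<^sub>R B) ** A = r *\<^sub>R (B ** A)"
      by (cases A rule: qmat_cases; cases B rule: qmat_cases; cases C rule: qmat_cases;
          simp add: qm_ops algebra_simps)+
  qed
  then show ?thesis by (simp add: bilinear_conv_bounded_bilinear)
qed

lemma bounded_linear_qadjoint: "bounded_linear qadjoint"
  unfolding linear_conv_bounded_linear[symmetric]
proof (rule linearI)
  fix A B :: qmat and r
  show "qadjoint (A + B) = qadjoint A + qadjoint B" "qadjoint (r *\<^sub>R A) = r *\<^sub>R qadjoint A"
    by (cases A rule: qmat_cases; cases B rule: qmat_cases; simp add: qm_ops qcnj_add)+
qed

lemma smooth_vec_qm:
  assumes "smooth_vec S a" "smooth_vec S b" "smooth_vec S c" "smooth_vec S d"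
  shows "smooth_vec S (\<lambda>x. qm (a x) (b x) (c x) (d x))"
  unfolding smooth_vec_def
proof
  fix B :: qmat assume "B \<in> Basis"
  then obtain i j u where u: "u \<in> Basis" and B: "B = axis i (axis j u)"
    by (auto simp: Basis_vec_def)
  have "(\<lambda>x. qm (a x) (b x) (c x) (d x) $ i $ j \<bullet> u) \<in> funs (submfd S)"
    using exhaust_2[of i] exhaust_2[of j] assms u by (auto simp: smooth_vec_def)
  then show "(\<lambda>x. qm (a x) (b x) (c x) (d x) \<bullet> B) \<in> funs (submfd S)"
    by (simp add: B inner_axis)
qed

lemma smooth_vec_qmat_nth: "smooth_vec S f \<Longrightarrow> smooth_vec S (\<lambda>x. f x $ i $ j)" for f :: "_ \<Rightarrow> qmat"
  by (intro smooth_vec_linear_comp[OF bounded_linear_vec_nth])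

lemmas smooth_vec_qmult = smooth_vec_bilinear[OF bounded_bilinear_quat_mult]
lemmas smooth_vec_qmatmult = smooth_vec_bilinear[OF bounded_bilinear_qmat_mult]
lemmas smooth_vec_qcnj = smooth_vec_linear_comp[OF bounded_linear_qcnj]
lemmas smooth_vec_qadjoint = smooth_vec_linear_comp[OF bounded_linear_qadjoint]
lemmas smooth_vec_fst = smooth_vec_linear_comp[OF bounded_linear_fst]
lemmas smooth_vec_snd = smooth_vec_linear_comp[OF bounded_linear_snd]

lemmas smooth_vec_intros = smooth_vec_qm smooth_vec_qmat_nth smooth_vec_qmult smooth_vec_qmatmult
  smooth_vec_qcnj smooth_vec_qadjoint smooth_vec_fst smooth_vec_snd smooth_vec_Pair smooth_vec_add
  smooth_vec_diff smooth_vec_uminus smooth_vec_scaleR smooth_vec_inner smooth_vec_mult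
  smooth_vec_const smooth_vec_id

lemma Sp2_iff: "Q \<in> Sp2 \<longleftrightarrow> qadjoint Q ** Q = mat 1"
  by (simp add: Sp2_def)

text \<open>
  Quaternions do not commute, so no determinant argument applies. But left multiplication by \<open>Q\<close> is an
  injective real-linear endomorphism of the finite-dimensional space of matrices, hence surjective,
  so \<open>Q\<close> has a right inverse.
\<close>

lemma Sp2_right_inverse:
  assumes "Q \<in> Sp2"
  shows "Q ** qadjoint Q = mat 1"
proof -
  have Q: "qadjoint Q ** Q = mat 1" using assms by (simp add: Sp2_iff)
  have A: "A = qadjoint Q ** (Q ** A)" for A :: qmat by (simp add: matrix_mul_assoc Q)
  have "linear (\<lambda>A::qmat. Q ** A)" unfolding linear_conv_bounded_linear
    by (rule bounded_bilinear.bounded_linear_right[OF bounded_bilinear_qmat_mult])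
  moreover have "inj (\<lambda>A::qmat. Q ** A)" by (rule injI) (metis A)
  ultimately have "surj (\<lambda>A::qmat. Q ** A)" by (rule linear_inj_imp_surj)
  then obtain B where B: "Q ** B = mat 1" by (metis surjD)
  with A[of B] have "B = qadjoint Q" by simp
  with B show ?thesis by simp
qed

lemma Sp2_mult:
  assumes "A \<in> Sp2" "B \<in> Sp2"
  shows "A ** B \<in> Sp2"
proof -
  have "qadjoint (A ** B) ** (A ** B) = qadjoint B ** (qadjoint A ** A) ** B"
    by (simp only: qadjoint_mult matrix_mul_assoc)
  then show ?thesis using assms by (simp add: Sp2_iff)
qed

lemma Sp2_adjoint: "Q \<in> Sp2 \<Longrightarrow> qadjoint Q \<in> Sp2"
  using Sp2_right_inverse by (simp add: Sp2_iff)

lemma qdiag_Sp2: "p \<in> S3 \<Longrightarrow> q \<in> S3 \<Longrightarrow> qdiag p q \<in> Sp2"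
  by (simp add: Sp2_iff qm_ops S3_iff qcnj_mult_self)

lemma Sp2_qm_rows_cols:
  assumes "qm a b c d \<in> Sp2"
  shows "a \<bullet> a + c \<bullet> c = 1" "b \<bullet> b + d \<bullet> d = 1" "qcnj a * b + qcnj c * d = 0"
    and "c \<bullet> c + d \<bullet> d = 1" "c \<bullet> a + d \<bullet> b = 0"
proof -
  show "a \<bullet> a + c \<bullet> c = 1" "b \<bullet> b + d \<bullet> d = 1" "qcnj a * b + qcnj c * d = 0"
    using assms by (simp_all add: Sp2_iff qm_ops qcnj_mult_self scaleR_one_quat_eq_iff
        flip: scaleR_add_left)
  have r: "c * qcnj c + d * qcnj d = 1" "c * qcnj a + d * qcnj b = 0"
    using Sp2_right_inverse[OF assms] by (simp_all add: qm_ops)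
  show "c \<bullet> c + d \<bullet> d = 1"
    using r(1) by (simp add: qcnj_mult_self scaleR_one_quat_eq_iff flip: scaleR_add_left)
  have "qRe (c * qcnj a + d * qcnj b) = 0" by (simp add: r(2) zero_quat_def)
  then show "c \<bullet> a + d \<bullet> b = 0" by (simp add: plus_quat_def qRe_mult_qcnj)
qed

section \<open>Points and frames as Hermitian matrices\<close>

definition herm :: "quat \<times> real \<Rightarrow> qmat"
  where "herm z = qm (snd z *\<^sub>R 1) (fst z) (qcnj (fst z)) (- snd z *\<^sub>R 1)"

lemma herm_inject: "herm y = herm z \<Longrightarrow> y = z"
  by (simp add: herm_def scaleR_one_quat_eq_iff prod_eq_iff)

lemma herm_anticommutator: "herm y ** herm z + herm z ** herm y = (2 * (y \<bullet> z)) *\<^sub>R mat 1"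
  by (cases y; cases z)
    (simp add: herm_def qm_ops, simp add: quat_ops quat_eq_iff algebra_simps)

definition q_delta :: qmat where "q_delta = qm (-1) 0 0 1"
definition q_sigma :: qmat where "q_sigma = qm 0 1 1 0"

definition base_pt :: "qmat \<Rightarrow> quat \<times> real"
  where "base_pt Q = hopf (lower_row Q)"

text \<open>
  Up to a factor 2, this is the derivative of \<open>hopf\<close> at the lower row of \<open>Q\<close> in the direction of the
  upper row; the second component \<open>a \<bullet> c - b \<bullet> d\<close> is \<open>2 (a \<bullet> c)\<close> because the rows are orthogonal.
\<close>

definition frame_vec :: "qmat \<Rightarrow> quat \<times> real"
  where "frame_vec Q =
    (qcnj (Q $ 1 $ 1) * Q $ 2 $ 2 + qcnj (Q $ 2 $ 1) * Q $ 1 $ 2, 2 * (Q $ 1 $ 1 \<bullet> Q $ 2 $ 1))"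

lemma herm_base_pt:
  assumes "Q \<in> Sp2"
  shows "herm (base_pt Q) = qadjoint Q ** q_delta ** Q"
proof (cases Q rule: qmat_cases)
  case (1 a b c d)
  note r = Sp2_qm_rows_cols[OF assms[unfolded 1]]
  have e: "- (qcnj a * b) = qcnj c * d" using r(3) by (simp add: eq_neg_iff_add_eq_0 neg_eq_iff_add_eq_0)
  then have "qcnj (- (qcnj a * b)) = qcnj (qcnj c * d)" by simp
  then have e': "- (qcnj b * a) = qcnj d * c" by (simp add: qcnj_mult)
  have a: "a \<bullet> a = d \<bullet> d" "b \<bullet> b = c \<bullet> c" using r by linarith+
  show ?thesis
    by (simp add: 1 base_pt_def hopf_def lower_row_def herm_def q_delta_def qm_ops e e' a
        qcnj_mult_self power2_norm_eq_inner scaleR_2 scaleR_diff_left qcnj_mult qcnj_add)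
qed

lemma herm_frame_vec:
  assumes "Q \<in> Sp2"
  shows "herm (frame_vec Q) = qadjoint Q ** q_sigma ** Q"
proof (cases Q rule: qmat_cases)
  case (1 a b c d)
  note r = Sp2_qm_rows_cols[OF assms[unfolded 1]]
  have "2 * (b \<bullet> d) = - (2 * (a \<bullet> c))" using r(5) by (simp add: inner_commute)
  then have "- ((2 * (a \<bullet> c)) *\<^sub>R (1::quat)) = (2 * (b \<bullet> d)) *\<^sub>R 1"
    by (simp only: scaleR_minus_left)
  then show ?thesis
    using qcnj_mult_sym[of a c] qcnj_mult_sym[of b d]
    by (simp add: 1 frame_vec_def herm_def q_sigma_def qm_ops qcnj_add qcnj_mult add.commute)
qed

lemma qadjoint_herm [simp]: "qadjoint (herm z) = herm z"
  by (simp add: herm_def qm_ops)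

lemma Sp2_conj_eq_iff:
  assumes "Q \<in> Sp2"
  shows "N = qadjoint Q ** M ** Q \<longleftrightarrow> M = Q ** N ** qadjoint Q"
proof -
  have 1: "qadjoint Q ** Q = mat 1" using assms by (simp add: Sp2_iff)
  have 2: "Q ** qadjoint Q = mat 1" using assms by (rule Sp2_right_inverse)
  have "qadjoint Q ** (Q ** N ** qadjoint Q) ** Q = (qadjoint Q ** Q) ** N ** (qadjoint Q ** Q)"
    "Q ** (qadjoint Q ** M ** Q) ** qadjoint Q = (Q ** qadjoint Q) ** M ** (Q ** qadjoint Q)"
    by (simp_all only: matrix_mul_assoc)
  then show ?thesis by (auto simp: 1 2)
qed

text \<open>
  Conjugation by a matrix of Sp(2) preserves anticommutators, so inner products of points of
  \<open>\<H> \<times> \<real>\<close> can be computed after conjugation.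
\<close>

lemma conj_anticommutator:
  assumes Q: "Q \<in> Sp2" and M: "M = Q ** herm y ** qadjoint Q" and N: "N = Q ** herm z ** qadjoint Q"
  shows "M ** N + N ** M = (2 * (y \<bullet> z)) *\<^sub>R mat 1"
proof -
  interpret bounded_bilinear "(**) :: qmat \<Rightarrow> qmat \<Rightarrow> qmat" by (rule bounded_bilinear_qmat_mult)
  have 1: "qadjoint Q ** Q = mat 1" using Q by (simp add: Sp2_iff)
  have p: "(Q ** A ** qadjoint Q) ** (Q ** B ** qadjoint Q) = Q ** (A ** B) ** qadjoint Q" for A B
  proof -
    have "(Q ** A ** qadjoint Q) ** (Q ** B ** qadjoint Q) =
        Q ** A ** (qadjoint Q ** Q) ** B ** qadjoint Q" by (simp only: matrix_mul_assoc)
    then show ?thesis by (simp add: 1 matrix_mul_assoc)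
  qed
  have "M ** N + N ** M = Q ** (herm y ** herm z + herm z ** herm y) ** qadjoint Q"
    by (simp only: M N p add_left add_right)
  also have "\<dots> = (2 * (y \<bullet> z)) *\<^sub>R (Q ** mat 1 ** qadjoint Q)"
    by (simp only: herm_anticommutator scaleR_left scaleR_right)
  finally show ?thesis by (simp add: Sp2_right_inverse[OF Q])
qed

lemma scaleR_mat_1_eq_iff: "a *\<^sub>R (mat 1 :: qmat) = b *\<^sub>R mat 1 \<longleftrightarrow> a = b"
  by (simp add: qm_ops scaleR_one_quat_eq_iff)

lemma base_frame_orthonormal:
  assumes Q: "Q \<in> Sp2"
  shows "base_pt Q \<bullet> base_pt Q = 1" "frame_vec Q \<bullet> frame_vec Q = 1" "base_pt Q \<bullet> frame_vec Q = 0"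
proof -
  have d: "q_delta = Q ** herm (base_pt Q) ** qadjoint Q"
    and s: "q_sigma = Q ** herm (frame_vec Q) ** qadjoint Q"
    using herm_base_pt[OF Q] herm_frame_vec[OF Q] Sp2_conj_eq_iff[OF Q] by blast+
  have "q_delta ** q_delta + q_delta ** q_delta = 2 *\<^sub>R mat 1"
    "q_sigma ** q_sigma + q_sigma ** q_sigma = 2 *\<^sub>R mat 1"
    "q_delta ** q_sigma + q_sigma ** q_delta = 0 *\<^sub>R mat 1"
    by (simp_all add: q_delta_def q_sigma_def qm_ops scaleR_2)
  then show "base_pt Q \<bullet> base_pt Q = 1" "frame_vec Q \<bullet> frame_vec Q = 1" "base_pt Q \<bullet> frame_vec Q = 0"
    unfolding conj_anticommutator[OF Q d d] conj_anticommutator[OF Q s s]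
      conj_anticommutator[OF Q d s] scaleR_mat_1_eq_iff by auto
qed

lemma conj_eq_imp_commute:
  assumes P: "P \<in> Sp2" and Q: "Q \<in> Sp2" and eq: "qadjoint P ** M ** P = qadjoint Q ** M ** Q"
  shows "M ** (P ** qadjoint Q) = (P ** qadjoint Q) ** M"
proof -
  have "M ** (P ** qadjoint Q) = (P ** qadjoint P) ** M ** P ** qadjoint Q"
    by (simp add: Sp2_right_inverse[OF P] matrix_mul_assoc)
  also have "\<dots> = P ** (qadjoint P ** M ** P) ** qadjoint Q" by (simp only: matrix_mul_assoc)
  also have "\<dots> = P ** (qadjoint Q ** M ** Q) ** qadjoint Q" by (simp only: eq)
  also have "\<dots> = (P ** qadjoint Q) ** M ** (Q ** qadjoint Q)" by (simp only: matrix_mul_assoc)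
  finally show ?thesis by (simp add: Sp2_right_inverse[OF Q])
qed

lemma Sp2_eq_mult:
  assumes Q: "Q \<in> Sp2" and R: "P ** qadjoint Q = R"
  shows "P = R ** Q"
proof -
  have "R ** Q = P ** (qadjoint Q ** Q)" by (simp only: R[symmetric] matrix_mul_assoc)
  also have "qadjoint Q ** Q = mat 1" using Q by (simp only: Sp2_iff)
  finally show ?thesis by simp
qed

text \<open>
  The quotient of two matrices in the same fibre commutes with \<open>\<delta>\<close>, hence is diagonal.
\<close>

lemma base_pt_fibre:
  assumes P: "P \<in> Sp2" and Q: "Q \<in> Sp2" and eq: "base_pt P = base_pt Q"
  shows "\<exists>p\<in>S3. \<exists>q\<in>S3. P ** qadjoint Q = qdiag p q"
proof -
  let ?R = "P ** qadjoint Q"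
  have R: "?R \<in> Sp2" using P Q by (intro Sp2_mult Sp2_adjoint)
  have c: "q_delta ** ?R = ?R ** q_delta"
    by (rule conj_eq_imp_commute[OF P Q])
      (simp only: herm_base_pt[OF P, symmetric] herm_base_pt[OF Q, symmetric] eq)
  obtain a b c d where abcd: "?R = qm a b c d" by (rule qmat_cases)
  have bc: "- b = b" "c = - c" using c unfolding abcd q_delta_def by (simp_all add: qm_ops)
  have "b = 0" by (rule quat_eq_minus_self(2)[OF bc(1)])
  moreover have "c = 0" by (rule quat_eq_minus_self(1)[OF bc(2)])
  ultimately have Rd: "?R = qdiag a d" by (simp add: abcd qdiag_qm)
  have ad: "a \<in> S3" "d \<in> S3"
    using R unfolding Rd by (simp_all add: Sp2_iff qm_ops S3_iff qcnj_mult_self scaleR_one_quat_eq_iff)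
  from ad Rd show ?thesis by blast
qed

lemma base_frame_fibre:
  assumes P: "P \<in> Sp2" and Q: "Q \<in> Sp2" and eq: "base_pt P = base_pt Q" "frame_vec P = frame_vec Q"
  shows "\<exists>p\<in>S3. P ** qadjoint Q = qdiag p p"
proof -
  obtain p q where pq: "p \<in> S3" "P ** qadjoint Q = qdiag p q"
    using base_pt_fibre[OF P Q eq(1)] by blast
  have "q_sigma ** qdiag p q = qdiag p q ** q_sigma"
    unfolding pq(2)[symmetric]
    by (rule conj_eq_imp_commute[OF P Q])
      (simp only: herm_frame_vec[OF P, symmetric] herm_frame_vec[OF Q, symmetric] eq)
  from arg_cong[OF this, of "\<lambda>A. A $ 1 $ 2"] have "p = q" by (simp add: q_sigma_def qm_ops)
  with pq show ?thesis by blast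
qed

lemma hopf_invariant: "p \<in> S3 \<Longrightarrow> hopf (p * c, p * d) = hopf (c, d)"
proof -
  assume p: "p \<in> S3"
  have "qcnj (p * c) * (p * d) = qcnj c * (qcnj p * p) * d"
    by (simp only: qcnj_mult mult.assoc)
  then show ?thesis
    using p by (simp add: hopf_def power2_norm_eq_inner inner_mult_left_quat S3_iff qcnj_mult_self)
qed

lemma base_pt_qdiag: "q \<in> S3 \<Longrightarrow> base_pt (qdiag p q ** Q) = base_pt Q"
  by (cases Q rule: qmat_cases) (simp add: base_pt_def lower_row_def qm_ops hopf_invariant)

lemma frame_vec_qdiag: "p \<in> S3 \<Longrightarrow> frame_vec (qdiag p p ** Q) = frame_vec Q"
proof -
  assume p: "p \<in> S3"
  have "qcnj (p * x) * (p * y) = qcnj x * y" for x y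
  proof -
    have "qcnj (p * x) * (p * y) = qcnj x * (qcnj p * p) * y"
      by (simp only: qcnj_mult mult.assoc)
    then show ?thesis using p by (simp add: S3_iff qcnj_mult_self)
  qed
  then show ?thesis using p
    by (cases Q rule: qmat_cases) (simp add: frame_vec_def qm_ops inner_mult_left_quat S3_iff)
qed

text \<open>
  The matrix \<open>Q v Q\<^sup>*\<close> anticommutes with \<open>\<delta>\<close> and squares to 1, so it is off-diagonal with entries
  \<open>u\<close> and \<open>qcnj u\<close> for a unit quaternion \<open>u\<close>. Multiplying the upper row of \<open>Q\<close> by \<open>qcnj u\<close> turns
  the conjugate of \<open>v\<close> into \<open>\<sigma>\<close>. As the formula is explicit, the lift is smooth in \<open>v\<close> and \<open>Q\<close>.
\<close>

lemma frame_lift: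
  assumes Q: "Q \<in> Sp2" and v: "v \<bullet> v = 1" "base_pt Q \<bullet> v = 0"
    and u: "u = (Q ** herm v ** qadjoint Q) $ 1 $ 2"
  shows "qdiag (qcnj u) 1 ** Q \<in> Sp2" "base_pt (qdiag (qcnj u) 1 ** Q) = base_pt Q"
    "frame_vec (qdiag (qcnj u) 1 ** Q) = v"
proof -
  define W where "W = Q ** herm v ** qadjoint Q"
  have Wh: "qadjoint W = W" by (simp only: W_def qadjoint_mult qadjoint_herm qadjoint_qadjoint matrix_mul_assoc)
  have d: "q_delta = Q ** herm (base_pt Q) ** qadjoint Q"
    using herm_base_pt[OF Q] Sp2_conj_eq_iff[OF Q] by blast
  have dW: "q_delta ** W + W ** q_delta = 0"
    using conj_anticommutator[OF Q d W_def] v(2) by simp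
  have WW: "W ** W + W ** W = 2 *\<^sub>R mat 1"
    using conj_anticommutator[OF Q W_def W_def] v(1) by simp
  obtain a b c e where abce: "W = qm a b c e" by (rule qmat_cases)
  have z0: "(0::qmat) = qm 0 0 0 0" by (simp add: qmat_eq_iff)
  have ae: "a = 0" "e = 0"
    using dW quat_add_self[of e] quat_eq_minus_self(2)[of a] unfolding abce q_delta_def z0
    by (simp_all add: qm_ops)
  have "u = W $ 1 $ 2" by (simp only: u W_def)
  then have "b = u" by (simp add: abce)
  moreover have "c = qcnj b" using Wh by (simp add: abce qm_ops)
  ultimately have Wu: "W = qm 0 u (qcnj u) 0" using abce ae by simp
  have "(2 * (u \<bullet> u)) *\<^sub>R (1::quat) = 2 *\<^sub>R 1"
    using WW unfolding Wu by (simp add: qm_ops qcnj_mult_self scaleR_2 flip: scaleR_add_left)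
  then have u1: "u \<in> S3" by (simp add: scaleR_one_quat_eq_iff S3_iff)
  then have D: "qdiag (qcnj u) 1 \<in> Sp2" by (intro qdiag_Sp2) (simp_all add: S3_iff)
  then show Q': "qdiag (qcnj u) 1 ** Q \<in> Sp2" using Q by (rule Sp2_mult)
  show "base_pt (qdiag (qcnj u) 1 ** Q) = base_pt Q" by (rule base_pt_qdiag) (simp add: S3_iff)
  have "herm (frame_vec (qdiag (qcnj u) 1 ** Q)) =
      qadjoint Q ** (qadjoint (qdiag (qcnj u) 1) ** q_sigma ** qdiag (qcnj u) 1) ** Q"
    by (simp only: herm_frame_vec[OF Q'] qadjoint_mult matrix_mul_assoc)
  also have "qadjoint (qdiag (qcnj u) 1) ** q_sigma ** qdiag (qcnj u) 1 = W"
    by (simp add: Wu q_sigma_def qm_ops)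
  also have "qadjoint Q ** W ** Q = herm v"
    using Sp2_conj_eq_iff[OF Q, of "herm v" W] W_def by simp
  finally show "frame_vec (qdiag (qcnj u) 1 ** Q) = v" by (rule herm_inject)
qed

text \<open>
  Over the sphere without its south pole each line contains a unit vector \<open>(c, d)\<close> with \<open>c\<close> real and
  positive. Solving \<open>hopf (c, d) = z\<close> gives \<open>c = s\<close> and \<open>d = w / (2 s)\<close>, and
  \<open>(- qcnj d, c)\<close> completes it to a matrix of Sp(2). In \<open>section_south\<close> it is \<open>d\<close> that is real and positive.
\<close>

definition section_north :: "quat \<times> real \<Rightarrow> qmat"
  where "section_north z = (let s = sqrt ((1 + snd z) * (1/2)) in
    qm (- (inverse (2 * s) *\<^sub>R qcnj (fst z))) (s *\<^sub>R 1) (s *\<^sub>R 1) (inverse (2 * s) *\<^sub>R fst z))"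

definition section_south :: "quat \<times> real \<Rightarrow> qmat"
  where "section_south z = (let s = sqrt ((1 - snd z) * (1/2)) in
    qm (s *\<^sub>R 1) (- (inverse (2 * s) *\<^sub>R fst z)) (inverse (2 * s) *\<^sub>R qcnj (fst z)) (s *\<^sub>R 1))"

lemma S4_iff: "z \<in> S4 \<longleftrightarrow> fst z \<bullet> fst z + snd z * snd z = 1"
  by (cases z) (simp add: S4_def norm_eq_1)

lemma section_aux:
  fixes t s w :: real
  assumes "w + t * t = 1" "s * s = (1 + t) * (1/2)" "s > 0"
  shows "inverse (2 * s) * (inverse (2 * s) * w) = (1 - t) / 2"
proof -
  have "w = (1 - t) * (1 + t)" using assms(1) by (simp add: algebra_simps)
  also have "1 + t = 2 * (s * s)" using assms(2) by simp
  finally have "w = 4 * (s * s) * ((1 - t) / 2)" by simp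
  then show ?thesis using assms(3) by (simp add: field_simps)
qed

lemma section_north:
  assumes z: "z \<in> S4" "snd z > - 1"
  shows "section_north z \<in> Sp2" "base_pt (section_north z) = z"
proof -
  define s where "s = sqrt ((1 + snd z) * (1/2))"
  have s: "s > 0" "s * s = (1 + snd z) * (1/2)" using z(2) by (simp_all add: s_def)
  note a = section_aux[OF z(1)[unfolded S4_iff] s(2,1)]
  have e: "section_north z =
    qm (- (inverse (2 * s) *\<^sub>R qcnj (fst z))) (s *\<^sub>R 1) (s *\<^sub>R 1) (inverse (2 * s) *\<^sub>R fst z)"
    by (simp only: section_north_def s_def Let_def)
  have *: "(2 - snd z * 2) / 4 + s * s = 1" "s * s + (2 - snd z * 2) / 4 = 1" using s(2) by (auto simp: field_simps)
  show "section_north z \<in> Sp2"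
    using a unfolding e
    by (simp add: * Sp2_iff qm_ops qcnj_mult_self flip: scaleR_add_left)
  have "s * s - (2 - snd z * 2) / 4 = snd z" using s(2) by (simp add: field_simps)
  with a s(1) show "base_pt (section_north z) = z" unfolding e
    by (simp add: base_pt_def lower_row_def hopf_def power2_norm_eq_inner prod_eq_iff)
qed

lemma section_south:
  assumes z: "z \<in> S4" "snd z < 1"
  shows "section_south z \<in> Sp2" "base_pt (section_south z) = z"
proof -
  define s where "s = sqrt ((1 - snd z) * (1/2))"
  have s: "s > 0" "s * s = (1 + - snd z) * (1/2)" using z(2) by (simp_all add: s_def)
  have "fst z \<bullet> fst z + (- snd z) * (- snd z) = 1" using z(1) by (simp add: S4_iff)
  note a = section_aux[OF this s(2,1)]
  have e: "section_south z =
    qm (s *\<^sub>R 1) (- (inverse (2 * s) *\<^sub>R fst z)) (inverse (2 * s) *\<^sub>R qcnj (fst z)) (s *\<^sub>R 1)"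
    by (simp only: section_south_def s_def Let_def)
  have *: "(2 + snd z * 2) / 4 + s * s = 1" "s * s + (2 + snd z * 2) / 4 = 1" using s(2) by (auto simp: field_simps)
  show "section_south z \<in> Sp2"
    using a unfolding e
    by (simp add: * Sp2_iff qm_ops qcnj_mult_self flip: scaleR_add_left)
  have "(2 + snd z * 2) / 4 - s * s = snd z" using s(2) by (simp add: field_simps)
  with a s(1) show "base_pt (section_south z) = z" unfolding e
    by (simp add: base_pt_def lower_row_def hopf_def power2_norm_eq_inner prod_eq_iff)
qed

lemma base_pt_local_section:
  assumes "z \<in> S4"
  obtains U s where "open U" "z \<in> U" "smooth_vec (S4 \<inter> U) s"
    "\<And>y. y \<in> S4 \<inter> U \<Longrightarrow> s y \<in> Sp2" "\<And>y. y \<in> S4 \<inter> U \<Longrightarrow> base_pt (s y) = y"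
proof (cases "snd z > - 1")
  case True
  let ?U = "{z :: quat \<times> real. snd z > - 1}"
  have "open ?U" by (intro open_Collect_less continuous_intros)
  moreover have "smooth_vec (S4 \<inter> ?U) section_north"
    unfolding section_north_def Let_def
    by (intro smooth_vec_intros smooth_vec_inverse smooth_vec_sqrt) auto
  ultimately show thesis using that[of ?U section_north] section_north True by auto
next
  case False
  let ?U = "{z :: quat \<times> real. snd z < 1}"
  have "open ?U" by (intro open_Collect_less continuous_intros)
  moreover have "smooth_vec (S4 \<inter> ?U) section_south"
    unfolding section_south_def Let_def
    by (intro smooth_vec_intros smooth_vec_inverse smooth_vec_sqrt) auto
  ultimately show thesis using that[of ?U section_south] section_south False by auto
qed

section \<open>The quotients of \<open>S\<^sup>7\<close> and Sp(2)\<close>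

lemma S3_mult: "p \<in> S3 \<Longrightarrow> q \<in> S3 \<Longrightarrow> p * q \<in> S3"
  by (simp add: S3_iff inner_mult_left_quat)

lemma S3_nonempty: "S3 \<noteq> {}"
  using S3_iff[of 1] by auto

lemma A_ud_eq: "A_ud g Q = qdiag (fst g) (snd g) ** Q"
proof -
  have "A_ud g Q = (qdiag (fst g) 1 ** qdiag 1 (snd g)) ** Q"
    by (simp add: A_ud_def A_u_def A_d_def case_prod_unfold matrix_mul_assoc)
  then show ?thesis by (simp add: qm_ops)
qed

lemma A20_eq: "A20 p Q = qdiag p p ** Q"
  by (cases Q rule: qmat_cases) (simp add: qm_ops, simp add: qmat_eq_iff A20_def)

lemma lower_row_S7: "Q \<in> Sp2 \<Longrightarrow> lower_row Q \<in> S7"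
  by (cases Q rule: qmat_cases)
    (simp add: lower_row_def S7_def norm_eq_1 Sp2_qm_rows_cols(4))

lemma smooth_vec_hopf: "smooth_vec S f \<Longrightarrow> smooth_vec S (\<lambda>x. hopf (f x))"
  unfolding hopf_def case_prod_unfold power2_norm_eq_inner by (intro smooth_vec_intros)

lemma smooth_vec_lower_row: "smooth_vec S f \<Longrightarrow> smooth_vec S (\<lambda>x. lower_row (f x))"
  unfolding lower_row_def by (intro smooth_vec_intros)

lemma smooth_vec_base_pt: "smooth_vec S base_pt"
  unfolding base_pt_def by (intro smooth_vec_hopf smooth_vec_lower_row smooth_vec_id)

lemma smooth_vec_frame_vec: "smooth_vec S frame_vec"
  unfolding frame_vec_def by (intro smooth_vec_intros)

lemma hopf_S4:
  assumes "z \<in> S7"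
  shows "hopf z \<in> S4"
proof (cases z)
  case (Pair c d)
  with assms have "c \<bullet> c + d \<bullet> d = 1" by (simp add: S7_def norm_eq_1)
  then have "(c \<bullet> c + d \<bullet> d) * (c \<bullet> c + d \<bullet> d) = 1" by simp
  then show ?thesis
    by (simp add: Pair hopf_def S4_iff power2_norm_eq_inner inner_mult_left_quat algebra_simps)
qed

lemma base_pt_S4: "Q \<in> Sp2 \<Longrightarrow> base_pt Q \<in> S4"
  unfolding base_pt_def by (intro hopf_S4 lower_row_S7)

text \<open>
  Points of the same fibre are unit vectors \<open>(c', d')\<close> and \<open>(c, d)\<close> of the same line; the multiplier is their
  quaternionic inner product \<open>c' qcnj c + d' qcnj d\<close>.
\<close>

lemma hopf_fibre:
  assumes x: "x \<in> S7" and y: "y \<in> S7" and eq: "hopf x = hopf y"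
  shows "\<exists>p\<in>S3. x = hopf_action p y"
proof -
  obtain c' d' c d where xy: "x = (c', d')" "y = (c, d)" by (cases x; cases y) auto
  have n: "c' \<bullet> c' + d' \<bullet> d' = 1" "c \<bullet> c + d \<bullet> d = 1"
    using x y by (simp_all add: xy S7_def norm_eq_1)
  have e: "qcnj c' * d' = qcnj c * d" "c' \<bullet> c' - d' \<bullet> d' = c \<bullet> c - d \<bullet> d"
    using eq by (simp_all add: xy hopf_def power2_norm_eq_inner)
  have nn: "c' \<bullet> c' = c \<bullet> c" "d' \<bullet> d' = d \<bullet> d" using n e(2) by linarith+
  have e': "qcnj d' * c' = qcnj d * c"
    using arg_cong[OF e(1), of qcnj] by (simp add: qcnj_mult)
  let ?p = "c' * qcnj c + d' * qcnj d"
  have "?p * c = c' * (qcnj c * c) + d' * (qcnj d * c)" by (simp add: algebra_simps)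
  also have "\<dots> = c' * (qcnj c * c) + (d' * qcnj d') * c'" by (simp only: e'[symmetric] mult.assoc)
  also have "\<dots> = (c \<bullet> c + d \<bullet> d) *\<^sub>R c'" by (simp add: qcnj_mult_self nn scaleR_add_left)
  finally have c: "?p * c = c'" by (simp add: n)
  have "?p * d = c' * (qcnj c * d) + d' * (qcnj d * d)" by (simp add: algebra_simps)
  also have "\<dots> = (c' * qcnj c') * d' + d' * (qcnj d * d)" by (simp only: e(1)[symmetric] mult.assoc)
  also have "\<dots> = (c \<bullet> c + d \<bullet> d) *\<^sub>R d'" by (simp add: qcnj_mult_self nn scaleR_add_left)
  finally have d: "?p * d = d'" by (simp add: n)
  have "(?p \<bullet> ?p) * (c \<bullet> c + d \<bullet> d) = (?p * c) \<bullet> (?p * c) + (?p * d) \<bullet> (?p * d)"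
    by (simp only: inner_mult_left_quat distrib_left)
  then have "?p \<in> S3" by (simp only: c d n S3_iff mult_1_right)
  moreover have "x = hopf_action ?p y" by (simp only: xy hopf_action_def prod.case c d)
  ultimately show ?thesis by blast
qed

lemma hopf_diffeomorphism:
  "diffeomorphism (orbit_space (submfd S7) hopf_action S3) (submfd S4) (descend hopf)"
proof (rule orbit_space_diffeomorphism)
  show "smooth_map (submfd S7) (submfd S4) hopf"
    using smooth_vec_hopf[OF smooth_vec_id] hopf_S4 by (intro smooth_vec_imp_smooth_map) auto
  show "S3 \<noteq> {}" by (rule S3_nonempty)
  show "hopf_action p z \<in> S7" if "p \<in> S3" "z \<in> S7" for p z
    using that by (cases z) (simp add: hopf_action_def S7_def norm_eq_1 inner_mult_left_quat S3_iff)
  show "hopf (hopf_action p z) = hopf z" if "p \<in> S3" for p z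
    using that by (cases z) (simp add: hopf_action_def hopf_invariant)
  show "\<exists>p\<in>S3. x = hopf_action p y" if "x \<in> S7" "y \<in> S7" "hopf x = hopf y" for x y
    using that by (rule hopf_fibre)
  fix y assume "y \<in> S4"
  then obtain U s where U: "open U" "y \<in> U" "smooth_vec (S4 \<inter> U) s"
    "\<And>y. y \<in> S4 \<inter> U \<Longrightarrow> s y \<in> Sp2" "\<And>y. y \<in> S4 \<inter> U \<Longrightarrow> base_pt (s y) = y"
    by (rule base_pt_local_section) blast
  have "smooth_map (submfd (S4 \<inter> U)) (submfd S7) (\<lambda>y. lower_row (s y))"
    by (intro smooth_vec_imp_smooth_map smooth_vec_lower_row U(3) image_subsetI lower_row_S7 U(4))
  moreover have "\<forall>z\<in>S4 \<inter> U. hopf (lower_row (s z)) = z"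
    using U(5) by (simp only: base_pt_def) blast
  ultimately show "\<exists>U s. open U \<and> y \<in> U \<and> smooth_map (submfd (S4 \<inter> U)) (submfd S7) s \<and>
      (\<forall>z\<in>S4 \<inter> U. hopf (s z) = z)" using U(1,2) by blast
qed

lemma S4_ident_eq: "S4_ident = descend base_pt"
  by (simp add: S4_ident_def base_pt_def[abs_def] o_def)

lemma Sp2_diffeomorphism:
  "diffeomorphism (orbit_space (submfd Sp2) A_ud (S3 \<times> S3)) (submfd S4) S4_ident"
  unfolding S4_ident_eq
proof (rule orbit_space_diffeomorphism)
  show "smooth_map (submfd Sp2) (submfd S4) base_pt"
    by (intro smooth_vec_imp_smooth_map smooth_vec_base_pt image_subsetI base_pt_S4)
  show "S3 \<times> S3 \<noteq> {}" using S3_nonempty by simp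
  show "A_ud g Q \<in> Sp2" if "g \<in> S3 \<times> S3" "Q \<in> Sp2" for g Q
    using that by (auto simp: A_ud_eq intro!: Sp2_mult qdiag_Sp2)
  show "base_pt (A_ud g Q) = base_pt Q" if "g \<in> S3 \<times> S3" for g Q
    using that by (auto simp: A_ud_eq base_pt_qdiag)
  show "\<exists>g\<in>S3 \<times> S3. P = A_ud g Q" if PQ: "P \<in> Sp2" "Q \<in> Sp2" "base_pt P = base_pt Q" for P Q
  proof -
    obtain p q where pq: "p \<in> S3" "q \<in> S3" "P ** qadjoint Q = qdiag p q"
      using base_pt_fibre[OF PQ] by blast
    from Sp2_eq_mult[OF PQ(2) pq(3)] have "P = A_ud (p, q) Q" by (simp only: A_ud_eq fst_conv snd_conv)
    with pq(1,2) show ?thesis by blast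
  qed
  fix y assume "y \<in> S4"
  then obtain U s where U: "open U" "y \<in> U" "smooth_vec (S4 \<inter> U) s"
    "\<And>y. y \<in> S4 \<inter> U \<Longrightarrow> s y \<in> Sp2" "\<And>y. y \<in> S4 \<inter> U \<Longrightarrow> base_pt (s y) = y"
    by (rule base_pt_local_section) blast
  have "smooth_map (submfd (S4 \<inter> U)) (submfd Sp2) s"
    by (intro smooth_vec_imp_smooth_map U(3) image_subsetI U(4))
  with U(1,2,5) show "\<exists>U s. open U \<and> y \<in> U \<and> smooth_map (submfd (S4 \<inter> U)) (submfd Sp2) s \<and>
    (\<forall>z\<in>S4 \<inter> U. base_pt (s z) = z)" by blast
qed

text \<open>
  A point \<open>(x, v)\<close> of the unit tangent bundle is lifted in two steps: a local section lifts \<open>x\<close>,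
  and \<open>frame_lift\<close> corrects the upper row so that the frame vector becomes \<open>v\<close>.
\<close>

lemma E20_diffeomorphism:
  "diffeomorphism E20 (unit_tangent_bundle S4 induced_metric) (descend (\<lambda>Q. (base_pt Q, frame_vec Q)))"
proof -
  let ?\<Phi> = "\<lambda>Q. (base_pt Q, frame_vec Q)"
  let ?T = "{(x, v). x \<in> S4 \<and> x \<bullet> v = 0 \<and> v \<in> S4}"
  have utb: "unit_tangent_bundle S4 induced_metric = submfd ?T"
    unfolding S4_def by (rule unit_tangent_bundle_sphere_induced)
  show ?thesis unfolding utb E20_def
  proof (rule orbit_space_diffeomorphism)
    show "smooth_map (submfd Sp2) (submfd ?T) ?\<Phi>"
    proof (intro smooth_vec_imp_smooth_map smooth_vec_Pair smooth_vec_base_pt smooth_vec_frame_vec)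
      show "?\<Phi> ` Sp2 \<subseteq> ?T"
        using base_frame_orthonormal base_pt_S4 by (auto simp: S4_def norm_eq_1)
    qed
    show "S3 \<noteq> {}" by (rule S3_nonempty)
    show "A20 p Q \<in> Sp2" if "p \<in> S3" "Q \<in> Sp2" for p Q
      using that by (auto simp: A20_eq intro!: Sp2_mult qdiag_Sp2)
    show "?\<Phi> (A20 p Q) = ?\<Phi> Q" if "p \<in> S3" for p Q
      using that by (auto simp: A20_eq base_pt_qdiag frame_vec_qdiag)
    show "\<exists>p\<in>S3. P = A20 p Q" if PQ: "P \<in> Sp2" "Q \<in> Sp2" "?\<Phi> P = ?\<Phi> Q" for P Q
    proof -
      obtain p where p: "p \<in> S3" "P ** qadjoint Q = qdiag p p"
        using base_frame_fibre[OF PQ(1,2)] PQ(3) by auto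
      from Sp2_eq_mult[OF PQ(2) p(2)] have "P = A20 p Q" by (simp only: A20_eq)
      with p(1) show ?thesis by blast
    qed
    fix y assume y: "y \<in> ?T"
    then have "fst y \<in> S4" by auto
    then obtain U s where U: "open U" "fst y \<in> U" "smooth_vec (S4 \<inter> U) s"
      "\<And>x. x \<in> S4 \<inter> U \<Longrightarrow> s x \<in> Sp2" "\<And>x. x \<in> S4 \<inter> U \<Longrightarrow> base_pt (s x) = x"
      by (rule base_pt_local_section) blast
    let ?V = "fst -` U :: ((quat \<times> real) \<times> (quat \<times> real)) set"
    let ?s = "\<lambda>z. s (fst z)"
    let ?u = "\<lambda>z. (?s z ** herm (snd z) ** qadjoint (?s z)) $ 1 $ 2"
    let ?t = "\<lambda>z. qdiag (qcnj (?u z)) 1 ** ?s z"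
    have z: "?t z \<in> Sp2" "?\<Phi> (?t z) = z" if "z \<in> ?T \<inter> ?V" for z
    proof -
      have z: "fst z \<in> S4 \<inter> U" "fst z \<bullet> snd z = 0" "snd z \<bullet> snd z = 1"
        using that by (auto simp: S4_def norm_eq_1)
      then have "base_pt (s (fst z)) \<bullet> snd z = 0" by (simp add: U(5))
      note l = frame_lift[OF U(4)[OF z(1)] z(3) this refl]
      show "?t z \<in> Sp2" by (rule l(1))
      have "?\<Phi> (?t z) = (base_pt (s (fst z)), snd z)" by (simp only: l(2,3))
      then show "?\<Phi> (?t z) = z" by (simp add: U(5)[OF z(1)])
    qed
    have "smooth_vec (?T \<inter> ?V) ?s"
      by (rule smooth_vec_compose[OF smooth_vec_fst[OF smooth_vec_id] _ U(3)]) auto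
    then have "smooth_vec (?T \<inter> ?V) ?t"
      unfolding qdiag_qm herm_def by (intro smooth_vec_intros)
    then have "smooth_map (submfd (?T \<inter> ?V)) (submfd Sp2) ?t"
      by (intro smooth_vec_imp_smooth_map image_subsetI z)
    moreover have "open ?V" using U(1) by (rule open_vimage_fst)
    moreover have "y \<in> ?V" using U(2) by simp
    moreover have "\<forall>z\<in>?T \<inter> ?V. ?\<Phi> (?t z) = z" using z(2) by blast
    ultimately show "\<exists>U s. open U \<and> y \<in> U \<and> smooth_map (submfd (?T \<inter> U)) (submfd Sp2) s \<and>
      (\<forall>z\<in>?T \<inter> U. ?\<Phi> (s z) = z)" by blast
  qed
qed

text \<open>
  Because \<open>A20 p\<close> is \<open>A_ud (p, p)\<close>, all \<open>A_ud\<close>-orbits in the union that defines \<open>p11\<close> coincide.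
\<close>

lemma p11_orbit: "p11 (orbit A20 S3 Q) = S4_ident (orbit A_ud (S3 \<times> S3) Q)"
proof -
  have sub: "orbit A_ud (S3 \<times> S3) (A20 p P) \<subseteq> orbit A_ud (S3 \<times> S3) P" if p: "p \<in> S3" for p P
  proof
    fix R assume "R \<in> orbit A_ud (S3 \<times> S3) (A20 p P)"
    then obtain a b where ab: "a \<in> S3" "b \<in> S3" "R = A_ud (a, b) (A20 p P)"
      by (auto simp: orbit_def)
    then have "R = (qdiag a b ** qdiag p p) ** P" by (simp add: A_ud_eq A20_eq matrix_mul_assoc)
    then have "R = A_ud (a * p, b * p) P" by (simp add: A_ud_eq qm_ops)
    moreover have "(a * p, b * p) \<in> S3 \<times> S3" using ab p by (simp add: S3_mult)
    ultimately show "R \<in> orbit A_ud (S3 \<times> S3) P" unfolding orbit_def by (rule image_eqI)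
  qed
  have "A20 1 Q = Q" by (simp add: A20_eq qdiag_qm flip: mat_1_qm)
  moreover have "1 \<in> S3" by (simp add: S3_iff)
  ultimately have "(\<Union>P\<in>orbit A20 S3 Q. orbit A_ud (S3 \<times> S3) P) = orbit A_ud (S3 \<times> S3) Q"
    using sub by (force simp: orbit_def[of A20])
  then show ?thesis by (simp add: p11_def)
qed

lemma S4_ident_orbit: "S4_ident (orbit A_ud (S3 \<times> S3) Q) = base_pt Q"
  unfolding S4_ident_eq
  by (rule descend_orbit) (auto simp: S3_nonempty A_ud_eq base_pt_qdiag)

section \<open>Factoring Riemannian submersions\<close>

lemma differential_compose:
  assumes "smooth_map Y Z q"
  shows "differential Z (q \<circ> p) D = differential Z q (differential Y p D)"
  using assms by (auto simp: differential_def smooth_map_def o_assoc fun_eq_iff)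

text \<open>
  The kernel of the differential of \<open>p\<close> lies in that of \<open>q \<circ> p\<close>, so a vector that is
  horizontal for \<open>q \<circ> p\<close> is horizontal for \<open>p\<close>, and the differential of \<open>p\<close> is isometric on it.
  Both \<open>push\<close> and \<open>lift\<close> in the proof use this: together they say that \<open>p\<close> maps the horizontal
  space of \<open>q \<circ> p\<close> onto that of \<open>q\<close>. All differentials of \<open>p\<close> have to be tangent vectors
  (the last assumption), since \<open>lift\<close> also pushes forward vectors that are not horizontal.
\<close>

lemma riemannian_submersion_factor:
  assumes p: "riemannian_submersion X g Y k p" and qp: "riemannian_submersion X g Z h (q \<circ> p)"
    and surj: "p ` points X = points Y" and q: "smooth_map Y Z q"
    and alg: "\<And>x D. x \<in> points X \<Longrightarrow> D \<in> tangent_space X x \<Longrightarrow>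
      differential Y p D \<in> tangent_space Y (p x)"
  shows "riemannian_submersion Y k Z h q"
  unfolding riemannian_submersion_def
proof (intro conjI ballI)
  show "riemannian_metric Y k" "riemannian_metric Z h" "smooth_map Y Z q"
    using p qp q by (simp_all add: riemannian_submersion_def)
  have g: "riemannian_metric X g" using p by (simp add: riemannian_submersion_def)
  note dc = differential_compose[OF q, of p]
  fix y assume "y \<in> points Y"
  then obtain x where x: "x \<in> points X" and y: "y = p x" using surj by auto
  let ?Hp = "horizontal_space X g Y p x" and ?Hqp = "horizontal_space X g Z (q \<circ> p) x"
    and ?Hq = "horizontal_space Y k Z q y"
  have p1: "differential Y p ` ?Hp = tangent_space Y y"
    and p2: "\<And>D E. D \<in> ?Hp \<Longrightarrow> E \<in> ?Hp \<Longrightarrow> k y (differential Y p D) (differential Y p E) = g x D E"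
    using p x by (auto simp: riemannian_submersion_def y)
  have qp1: "differential Z (q \<circ> p) ` ?Hqp = tangent_space Z (q y)"
    and qp2: "\<And>D E. D \<in> ?Hqp \<Longrightarrow> E \<in> ?Hqp \<Longrightarrow>
      h (q y) (differential Z (q \<circ> p) D) (differential Z (q \<circ> p) E) = g x D E"
    using qp x by (auto simp: riemannian_submersion_def y)
  have zero: "differential Z q (\<lambda>_. 0) = (\<lambda>_. 0)" by (simp add: differential_def)
  have Hqp_Hp: "D \<in> ?Hp" if "D \<in> ?Hqp" for D
    using that zero unfolding horizontal_space_def by (auto simp: dc)
  have push: "differential Y p D \<in> ?Hq" if D: "D \<in> ?Hqp" for D
    unfolding horizontal_space_def
  proof (intro CollectI conjI ballI impI)
    show "differential Y p D \<in> tangent_space Y y" using p1 Hqp_Hp[OF D] by blast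
    fix K assume "K \<in> tangent_space Y y" and K0: "differential Z q K = (\<lambda>_. 0)"
    then obtain L where L: "L \<in> ?Hp" "K = differential Y p L" using p1 by blast
    have "g x D L = 0"
      using D L K0 unfolding horizontal_space_def by (auto simp: dc)
    then show "k y (differential Y p D) K = 0" using p2[OF Hqp_Hp[OF D] L(1)] L(2) by simp
  qed
  have lift: "\<exists>D\<in>?Hqp. E = differential Y p D" if E: "E \<in> ?Hq" for E
  proof -
    have ET: "E \<in> tangent_space Y y" using E by (simp add: horizontal_space_def)
    then obtain D where D: "D \<in> ?Hp" "E = differential Y p D" using p1 by blast
    have DT: "D \<in> tangent_space X x" using D(1) by (simp add: horizontal_space_def)
    have "D \<in> ?Hqp" unfolding horizontal_space_def
    proof (intro CollectI conjI ballI impI DT)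
      fix K assume K: "K \<in> tangent_space X x" and K0: "differential Z (q \<circ> p) K = (\<lambda>_. 0)"
      have "differential Y p K \<in> tangent_space Y y" using alg[OF x K] by (simp add: y)
      then obtain L where L: "L \<in> ?Hp" "differential Y p K = differential Y p L" using p1 by blast
      have LT: "L \<in> tangent_space X x" using L(1) by (simp add: horizontal_space_def)
      have "k y E (differential Y p K) = 0"
        using E \<open>differential Y p K \<in> tangent_space Y y\<close> K0 by (simp add: horizontal_space_def dc)
      then have DL: "g x D L = 0" using p2[OF D(1) L(1)] by (simp add: D(2) L(2))
      \<comment> \<open>the vertical part of \<open>K\<close>\<close>
      let ?M = "\<lambda>f. K f + (-1) * L f"
      have nL: "(\<lambda>f. (-1) * L f) \<in> tangent_space X x" by (rule tangent_space_scale[OF LT LT])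
      have M: "?M \<in> tangent_space X x" by (rule tangent_space_plus[OF K nL])
      have "differential Y p ?M f = 0" for f
        using fun_cong[OF L(2), of f] by (cases "f \<in> funs Y") (simp_all add: differential_def)
      then have "differential Y p ?M = (\<lambda>_. 0)" by (rule ext)
      then have "g x D ?M = 0" using D(1) M by (simp add: horizontal_space_def)
      then have "g x ?M D = 0" using riemannian_metric_sym[OF g x DT M] by simp
      moreover have "g x ?M D = g x K D + (-1) * g x L D"
        using riemannian_metric_add[OF g x K nL DT] riemannian_metric_scale[OF g x LT DT, of "-1"] by simp
      ultimately show "g x D K = 0"
        using DL riemannian_metric_sym[OF g x DT LT] riemannian_metric_sym[OF g x DT K] by simp
    qed
    with D(2) show ?thesis by blast
  qed
  show "differential Z q ` ?Hq = tangent_space Z (q y)"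
  proof
    show "differential Z q ` ?Hq \<subseteq> tangent_space Z (q y)"
    proof (rule image_subsetI)
      fix E assume "E \<in> ?Hq"
      then obtain D where "D \<in> ?Hqp" "E = differential Y p D" using lift by blast
      then show "differential Z q E \<in> tangent_space Z (q y)" using qp1 by (simp add: dc) blast
    qed
    show "tangent_space Z (q y) \<subseteq> differential Z q ` ?Hq"
    proof
      fix F assume "F \<in> tangent_space Z (q y)"
      then obtain D where D: "D \<in> ?Hqp" "F = differential Z (q \<circ> p) D" using qp1 by blast
      then have "F = differential Z q (differential Y p D)" by (simp only: dc)
      then show "F \<in> differential Z q ` ?Hq" using push[OF D(1)] by blast
    qed
  qed
  fix E F assume "E \<in> ?Hq" "F \<in> ?Hq"
  then obtain D C where D: "D \<in> ?Hqp" "E = differential Y p D" and C: "C \<in> ?Hqp" "F = differential Y p C"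
    using lift by metis
  have "h (q y) (differential Z q E) (differential Z q F) = g x D C"
    using qp2[OF D(1) C(1)] by (simp only: D(2) C(2) dc)
  also have "\<dots> = k y E F" using p2[OF Hqp_Hp Hqp_Hp, OF D(1) C(1)] by (simp only: D(2) C(2))
  finally show "h (q y) (differential Z q E) (differential Z q F) = k y E F" .
qed

lemma differential_orbit_tangent:
  assumes D: "D \<in> tangent_space (submfd S) x"
  shows "differential (orbit_space (submfd S) act G) (orbit act G) D
    \<in> tangent_space (orbit_space (submfd S) act G) (orbit act G x)"
  unfolding tangent_space_def
proof (intro CollectI conjI allI ballI impI)
  let ?Y = "orbit_space (submfd S) act G" and ?o = "orbit act G"
  have G: "f \<in> funs ?Y \<longleftrightarrow> f \<circ> ?o \<in> funs (submfd S)" for f by (simp add: orbit_space_def)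
  let ?d = "differential ?Y ?o D"
  show "?d f = 0" if "f \<notin> funs ?Y" for f using that by (simp add: differential_def)
  fix f assume f: "f \<in> funs ?Y"
  then have f': "f \<circ> ?o \<in> funs (submfd S)" by (simp add: G)
  have c: "(\<lambda>y. c * (f \<circ> ?o) y) \<in> funs (submfd S)" for c by (rule funs_mult[OF funs_const f'])
  show "?d (\<lambda>y. c * f y) = c * ?d f" for c
    using tangent_space_cmult[OF D f', of c] c[of c] f' by (simp add: differential_def G o_def)
  fix h assume "h \<in> funs ?Y"
  then have h': "h \<circ> ?o \<in> funs (submfd S)" by (simp add: G)
  show "?d (\<lambda>y. f y + h y) = ?d f + ?d h"
    using tangent_space_add[OF D f' h'] funs_add[OF f' h'] f' h' by (simp add: differential_def G o_def)
  show "?d (\<lambda>y. f y * h y) = f (?o x) * ?d h + h (?o x) * ?d f"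
    using tangent_space_mult[OF D f' h'] funs_mult[OF f' h'] f' h' by (simp add: differential_def G o_def)
qed

section \<open>The bundle isomorphism\<close>

lemma E20_bundle_iso:
  "bundle_isomorphic E20 p11 (unit_tangent_bundle S4 induced_metric) fst"
  unfolding bundle_isomorphic_def
proof (intro exI conjI ballI)
  show "diffeomorphism E20 (unit_tangent_bundle S4 induced_metric) (descend (\<lambda>Q. (base_pt Q, frame_vec Q)))"
    by (rule E20_diffeomorphism)
  fix C assume "C \<in> points E20"
  then obtain Q where C: "C = orbit A20 S3 Q" by (auto simp: E20_def orbit_space_def)
  have "descend (\<lambda>Q. (base_pt Q, frame_vec Q)) C = (base_pt Q, frame_vec Q)"
    unfolding C by (rule descend_orbit) (simp_all add: S3_nonempty A20_eq base_pt_qdiag frame_vec_qdiag)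
  then show "fst (descend (\<lambda>Q. (base_pt Q, frame_vec Q)) C) = p11 C"
    by (simp add: C p11_orbit S4_ident_orbit)
qed

lemma p11_riemannian_submersion:
  assumes E: "riemannian_submersion (submfd Sp2) gSp E20 gE (orbit A20 S3)"
    and B: "riemannian_submersion (submfd Sp2) gSp (submfd S4) gS4 (S4_ident \<circ> orbit A_ud (S3 \<times> S3))"
  shows "riemannian_submersion E20 gE (submfd S4) gS4 p11"
proof (rule riemannian_submersion_factor[OF E])
  have e: "S4_ident \<circ> orbit A_ud (S3 \<times> S3) = p11 \<circ> orbit A20 S3"
    by (simp add: fun_eq_iff p11_orbit)
  show "riemannian_submersion (submfd Sp2) gSp (submfd S4) gS4 (p11 \<circ> orbit A20 S3)"
    using B by (simp only: e)
  have pts: "points E20 = orbit A20 S3 ` Sp2" by (simp add: E20_def orbit_space_def)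
  have fns: "f \<in> funs E20 \<longleftrightarrow> f \<circ> orbit A20 S3 \<in> funs (submfd Sp2)" for f
    by (simp add: E20_def orbit_space_def)
  show "orbit A20 S3 ` points (submfd Sp2) = points E20" by (simp add: pts)
  have "smooth_map (submfd Sp2) (submfd S4) (p11 \<circ> orbit A20 S3)"
    using B by (simp add: riemannian_submersion_def e)
  then show "smooth_map E20 (submfd S4) p11"
    by (simp add: smooth_map_def fns pts image_comp o_assoc)
  show "differential E20 (orbit A20 S3) D \<in> tangent_space E20 (orbit A20 S3 Q)"
    if "D \<in> tangent_space (submfd Sp2) Q" for Q D
    using differential_orbit_tangent[OF that, of A20 S3] by (simp only: E20_def)
qed

lemma bundle_isomorphic_metric:
  assumes "riemannian_metric (submfd S4) g"
  shows "bundle_isomorphic E20 p11 (unit_tangent_bundle S4 g) fst"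
proof -
  obtain \<Psi> where \<Psi>: "diffeomorphism (unit_tangent_bundle S4 induced_metric) (unit_tangent_bundle S4 g) \<Psi>"
    "\<And>z. fst (\<Psi> z) = fst z"
    using unit_tangent_bundles_isomorphic[OF assms[unfolded S4_def]] unfolding S4_def by blast
  obtain \<Phi> where \<Phi>: "diffeomorphism E20 (unit_tangent_bundle S4 induced_metric) \<Phi>"
    "\<forall>C\<in>points E20. fst (\<Phi> C) = p11 C"
    using E20_bundle_iso unfolding bundle_isomorphic_def by blast
  have "diffeomorphism E20 (unit_tangent_bundle S4 g) (\<Psi> \<circ> \<Phi>)"
    using diffeomorphism_compose[OF \<Phi>(1)] \<Psi>(1) by (simp add: unit_tangent_bundle_def)
  moreover have "\<forall>C\<in>points E20. fst ((\<Psi> \<circ> \<Phi>) C) = p11 C" using \<Phi>(2) \<Psi>(2) by simp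
  ultimately show ?thesis unfolding bundle_isomorphic_def by blast
qed

theorem proposition9p1:
  shows
    \<comment> \<open>the 4-sphere, with \<open>hopf\<close> and \<open>S4_ident\<close>, is a model of the quotients in question\<close>
    "diffeomorphism (orbit_space (submfd S7) hopf_action S3) (submfd S4) (descend hopf) \<and>
     diffeomorphism (orbit_space (submfd Sp2) A_ud (S3 \<times> S3)) (submfd S4) S4_ident \<and>
     diffeomorphic E20 (unit_tangent_bundle S4 induced_metric) \<and>
     (\<forall>Q\<in>Sp2. p11 (orbit A20 S3 Q) = hopf (lower_row Q)) \<and>
     bundle_isomorphic E20 p11 (unit_tangent_bundle S4 induced_metric) fst \<and>
     (\<forall>(g0 :: qmat metric) (b1 :: quat metric) (b2 :: quat metric) (b3 :: quat metric)
        (b4 :: quat metric) (gSp :: qmat metric) (gE :: qmat set metric)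
        (gS4 :: (quat \<times> real) metric).
        biinvariant_metric (submfd Sp2) (**) g0 \<and>
        biinvariant_metric (submfd S3) (*) b1 \<and> biinvariant_metric (submfd S3) (*) b2 \<and>
        biinvariant_metric (submfd S3) (*) b3 \<and> biinvariant_metric (submfd S3) (*) b4 \<and>
        cheeger_metric g0 b1 b2 b3 b4 gSp \<and>
        riemannian_submersion (submfd Sp2) gSp E20 gE (orbit A20 S3) \<and>
        riemannian_submersion (submfd Sp2) gSp (submfd S4) gS4
          (S4_ident \<circ> orbit A_ud (S3 \<times> S3)) \<longrightarrow>
        riemannian_submersion E20 gE (submfd S4) gS4 p11 \<and>
        bundle_isomorphic E20 p11 (unit_tangent_bundle S4 gS4) fst)"
proof (intro conjI allI impI ballI; (elim conjE)?)
  show "diffeomorphism (orbit_space (submfd S7) hopf_action S3) (submfd S4) (descend hopf)"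
    by (rule hopf_diffeomorphism)
  show "diffeomorphism (orbit_space (submfd Sp2) A_ud (S3 \<times> S3)) (submfd S4) S4_ident"
    by (rule Sp2_diffeomorphism)
  show "diffeomorphic E20 (unit_tangent_bundle S4 induced_metric)"
    unfolding diffeomorphic_def using E20_diffeomorphism by blast
  show "p11 (orbit A20 S3 Q) = hopf (lower_row Q)" for Q
    by (simp add: p11_orbit S4_ident_orbit base_pt_def)
  show "bundle_isomorphic E20 p11 (unit_tangent_bundle S4 induced_metric) fst"
    by (rule E20_bundle_iso)
  fix gSp gE gS4
  assume E: "riemannian_submersion (submfd Sp2) gSp E20 gE (orbit A20 S3)"
    and B: "riemannian_submersion (submfd Sp2) gSp (submfd S4) gS4 (S4_ident \<circ> orbit A_ud (S3 \<times> S3))"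
  show "riemannian_submersion E20 gE (submfd S4) gS4 p11"
    by (rule p11_riemannian_submersion[OF E B])
  show "bundle_isomorphic E20 p11 (unit_tangent_bundle S4 gS4) fst"
    by (rule bundle_isomorphic_metric) (use B in \<open>simp add: riemannian_submersion_def\<close>)
qed

end
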